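(* Let $\phi:E\to\,]-\infty,+\infty]$ be proper, lower semicontinuous and convex with open domain. Suppose that the Fenchel conjugate $\phi^*$ is differentiable (everywhere) on $E$. Then $I_\phi$ is strongly rotund on $L^1_E(S,\mu)$.
   Context: $d\in\{1,2,3,\dots\}$ and $E=\mathbb{R}^d$ is Euclidean space with its Euclidean norm. $(S,\mu)$ is a complete finite measure space with $\mu\neq 0$. $L^1_E(S,\mu)$ is the Banach space of (equivalence classes of) measurable $f:S\to E$ with $\|f\|_1:=\int_S\|f(s)\|\,d\mu(s)<+\infty$; its dual is $L^\infty_E(S,\mu)$ via $\langle f,g\rangle=\int_S\langle f(s),g(s)\rangle\,d\mu(s)$. For a function $f:X\to\,]-\infty,+\infty]$ on a Banach space, $\operatorname{dom} f:=\{x: f(x)<+\infty\}$, $f$ is proper if $\operatorname{dom} f\neq\varnothing$, and $f^*(x^* ):=\sup_x(\langle x,x^*\rangle-f(x))$. The integral functional is $I_\phi:L^1_E(S,\mu)\to\,]-\infty,+\infty]$, $I_\phi(x):=\int_S\phi(x(s))\,d\mu(s)$. A proper function $f:X\to\,]-\infty,+\infty]$ is strongly rotund if (1) $f$ is strictly convex on its domain; (2) all lower level sets $\{x\in X: f(x)\le\lambda\}$, $\lambda\in\mathbb{R}$, are weakly compact; and (3) $f$ has the Kadec (Kadec--Klee) property: whenever a sequence $(x_n)$ converges weakly to $x\in\operatorname{dom} f$ and $f(x_n)\to f(x)$, then $x_n\to x$ in norm. *)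

theory Defs
  imports "HOL-Analysis.Analysis"
begin

section \<open>Extended-real-valued functions\<close>

definition effective_domain :: "'a set \<Rightarrow> ('a \<Rightarrow> ereal) \<Rightarrow> 'a set" where
  "effective_domain X f = {x \<in> X. f x < \<infinity>}"

text \<open>A proper function into \<open>]-\<infinity>, \<infinity>]\<close>; excluding the value \<open>-\<infinity>\<close> renders the codomain.\<close>

definition proper_on :: "'a set \<Rightarrow> ('a \<Rightarrow> ereal) \<Rightarrow> bool" where
  "proper_on X f \<longleftrightarrow> (\<forall>x\<in>X. f x \<noteq> -\<infinity>) \<and> effective_domain X f \<noteq> {}"

definition lsc :: "('a::topological_space \<Rightarrow> ereal) \<Rightarrow> bool" where
  "lsc f \<longleftrightarrow> (\<forall>x. f x \<le> Liminf (at x) f)"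

text \<open>The weights \<open>0\<close> and \<open>1\<close> are left out because \<open>0 * \<infinity> = 0\<close> in \<^typ>\<open>ereal\<close>.\<close>

definition convex_ereal :: "('a::real_vector \<Rightarrow> ereal) \<Rightarrow> bool" where
  "convex_ereal f \<longleftrightarrow>
     (\<forall>x y. \<forall>t::real. 0 < t \<and> t < 1 \<longrightarrow>
        f ((1 - t) *\<^sub>R x + t *\<^sub>R y) \<le> ereal (1 - t) * f x + ereal t * f y)"

definition fenchel_conjugate :: "('a::real_inner \<Rightarrow> ereal) \<Rightarrow> 'a \<Rightarrow> ereal" where
  "fenchel_conjugate f y = (SUP x. ereal (x \<bullet> y) - f x)"

text \<open>Differentiability at a point includes finiteness in a neighbourhood of that point.\<close>

definition ereal_differentiable :: "('a::real_normed_vector \<Rightarrow> ereal) \<Rightarrow> 'a \<Rightarrow> bool" where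
  "ereal_differentiable f x \<longleftrightarrow>
     (\<forall>\<^sub>F y in nhds x. \<bar>f y\<bar> \<noteq> \<infinity>) \<and> (\<lambda>y. real_of_ereal (f y)) differentiable (at x)"


section \<open>Normed spaces with an explicit carrier\<close>

text \<open>
  The space \<open>L\<^sup>1(M)\<close> depends on the measure \<open>M\<close>, hence is not a type and cannot be an
  instance of the class \<^class>\<open>banach\<close>. Its operations are therefore passed explicitly.
\<close>

record 'v nvs =
  vcarrier :: "'v set"
  vadd :: "'v \<Rightarrow> 'v \<Rightarrow> 'v"
  vscale :: "real \<Rightarrow> 'v \<Rightarrow> 'v"
  vnorm :: "'v \<Rightarrow> real"

definition vdiff :: "'v nvs \<Rightarrow> 'v \<Rightarrow> 'v \<Rightarrow> 'v" where
  "vdiff X x y = vadd X x (vscale X (-1) y)"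

definition dual_space :: "'v nvs \<Rightarrow> ('v \<Rightarrow> real) set" where
  "dual_space X = {\<Lambda>.
     (\<forall>x\<in>vcarrier X. \<forall>y\<in>vcarrier X. \<Lambda> (vadd X x y) = \<Lambda> x + \<Lambda> y) \<and>
     (\<forall>c. \<forall>x\<in>vcarrier X. \<Lambda> (vscale X c x) = c * \<Lambda> x) \<and>
     (\<exists>B. \<forall>x\<in>vcarrier X. \<bar>\<Lambda> x\<bar> \<le> B * vnorm X x)}"

definition weak_topology :: "'v nvs \<Rightarrow> 'v topology" where
  "weak_topology X =
     topology_generated_by {{x \<in> vcarrier X. \<Lambda> x \<in> U} | \<Lambda> U. \<Lambda> \<in> dual_space X \<and> open U}"

definition strictly_convex_on_domain :: "'v nvs \<Rightarrow> ('v \<Rightarrow> ereal) \<Rightarrow> bool" where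
  "strictly_convex_on_domain X f \<longleftrightarrow>
     (\<forall>x \<in> effective_domain (vcarrier X) f. \<forall>y \<in> effective_domain (vcarrier X) f.
        \<forall>t::real. x \<noteq> y \<and> 0 < t \<and> t < 1 \<longrightarrow>
          f (vadd X (vscale X (1 - t) x) (vscale X t y)) < ereal (1 - t) * f x + ereal t * f y)"

definition weakly_compact_level_sets :: "'v nvs \<Rightarrow> ('v \<Rightarrow> ereal) \<Rightarrow> bool" where
  "weakly_compact_level_sets X f \<longleftrightarrow>
     (\<forall>\<alpha>::real. compactin (weak_topology X) {x \<in> vcarrier X. f x \<le> ereal \<alpha>})"

definition kadec_property :: "'v nvs \<Rightarrow> ('v \<Rightarrow> ereal) \<Rightarrow> bool" where
  "kadec_property X f \<longleftrightarrow>
     (\<forall>u x. (\<forall>n::nat. u n \<in> vcarrier X) \<and> x \<in> effective_domain (vcarrier X) f \<and>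
        limitin (weak_topology X) u x sequentially \<and> (\<lambda>n. f (u n)) \<longlonglongrightarrow> f x \<longrightarrow>
        (\<lambda>n. vnorm X (vdiff X (u n) x)) \<longlonglongrightarrow> 0)"

definition strongly_rotund :: "'v nvs \<Rightarrow> ('v \<Rightarrow> ereal) \<Rightarrow> bool" where
  "strongly_rotund X f \<longleftrightarrow>
     proper_on (vcarrier X) f \<and>
     strictly_convex_on_domain X f \<and>
     weakly_compact_level_sets X f \<and>
     kadec_property X f"


section \<open>The space \<open>L\<^sup>1\<close> and integral functionals\<close>

definition L1_rel :: "'s measure \<Rightarrow> (('s \<Rightarrow> 'e) \<times> ('s \<Rightarrow> 'e::euclidean_space)) set" where
  "L1_rel M = {(f, g). integrable M f \<and> integrable M g \<and> (AE s in M. f s = g s)}"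

definition L1_class :: "'s measure \<Rightarrow> ('s \<Rightarrow> 'e::euclidean_space) \<Rightarrow> ('s \<Rightarrow> 'e) set" where
  "L1_class M f = L1_rel M `` {f}"

definition L1_rep :: "('s \<Rightarrow> 'e) set \<Rightarrow> 's \<Rightarrow> 'e" where
  "L1_rep x = (SOME f. f \<in> x)"

definition L1_space :: "'s measure \<Rightarrow> ('s \<Rightarrow> 'e::euclidean_space) set nvs" where
  "L1_space M =
     \<lparr>vcarrier = {f. integrable M f} // L1_rel M,
      vadd = (\<lambda>x y. L1_class M (\<lambda>s. L1_rep x s + L1_rep y s)),
      vscale = (\<lambda>c x. L1_class M (\<lambda>s. c *\<^sub>R L1_rep x s)),
      vnorm = (\<lambda>x. \<integral>s. norm (L1_rep x s) \<partial>M)\<rparr>"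

text \<open>
  Positive part minus negative part. In \<^typ>\<open>ereal\<close>, \<open>\<infinity> - \<infinity> = \<infinity>\<close>, the usual convention for
  integral functionals. For proper lower semicontinuous convex \<open>\<phi>\<close> and a finite measure the
  negative part of \<open>\<phi> \<circ> x\<close> has a finite integral, as \<open>\<phi>\<close> has an affine minorant.
\<close>

definition ereal_integral :: "'s measure \<Rightarrow> ('s \<Rightarrow> ereal) \<Rightarrow> ereal" where
  "ereal_integral M h =
     enn2ereal (\<integral>\<^sup>+ s. e2ennreal (h s) \<partial>M) - enn2ereal (\<integral>\<^sup>+ s. e2ennreal (- h s) \<partial>M)"

definition integral_functional ::
    "'s measure \<Rightarrow> ('e \<Rightarrow> ereal) \<Rightarrow> ('s \<Rightarrow> 'e) set \<Rightarrow> ereal" where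
  "integral_functional M \<phi> x = ereal_integral M (\<lambda>s. \<phi> (L1_rep x s))"

text \<open>
  All the operations on classes are independent of the representative chosen by \<open>L1_rep\<close>.
\<close>

lemma L1_rep_AE:
  fixes f :: "'s \<Rightarrow> 'e::euclidean_space"
  assumes "integrable M f"
  shows "integrable M (L1_rep (L1_class M f))" "AE s in M. L1_rep (L1_class M f) s = f s"
proof -
  have "f \<in> L1_class M f"
    using assms by (simp add: L1_class_def L1_rel_def)
  then have "L1_rep (L1_class M f) \<in> L1_class M f"
    unfolding L1_rep_def by (rule someI[where P="\<lambda>h. h \<in> L1_class M f"])
  then show "integrable M (L1_rep (L1_class M f))" "AE s in M. L1_rep (L1_class M f) s = f s"
    by (auto simp: L1_class_def L1_rel_def)
qed

lemma L1_class_eq_iff: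
  fixes f g :: "'s \<Rightarrow> 'e::euclidean_space"
  assumes "integrable M f" "integrable M g"
  shows "L1_class M f = L1_class M g \<longleftrightarrow> (AE s in M. f s = g s)"
proof
  assume "L1_class M f = L1_class M g"
  then have "g \<in> L1_class M f"
    using assms by (simp add: L1_class_def L1_rel_def)
  then show "AE s in M. f s = g s"
    by (simp add: L1_class_def L1_rel_def)
next
  assume fg: "AE s in M. f s = g s"
  have "(AE s in M. f s = h s) \<longleftrightarrow> (AE s in M. g s = h s)" for h
    using fg by (intro iffI; elim AE_mp; auto)
  then show "L1_class M f = L1_class M g"
    using assms by (auto simp: L1_class_def L1_rel_def)
qed

lemma L1_space_simps:
  fixes f g :: "'s \<Rightarrow> 'e::euclidean_space"
  assumes f: "integrable M f" and g: "integrable M g"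
  shows "L1_class M f \<in> vcarrier (L1_space M)"
    and "vadd (L1_space M) (L1_class M f) (L1_class M g) = L1_class M (\<lambda>s. f s + g s)"
    and "vscale (L1_space M) c (L1_class M f) = L1_class M (\<lambda>s. c *\<^sub>R f s)"
    and "vnorm (L1_space M) (L1_class M f) = (\<integral>s. norm (f s) \<partial>M)"
proof -
  note rf = L1_rep_AE[OF f] and rg = L1_rep_AE[OF g]
  show "L1_class M f \<in> vcarrier (L1_space M)"
    using f by (auto simp: L1_space_def L1_class_def intro: quotientI)
  have "AE s in M. L1_rep (L1_class M f) s + L1_rep (L1_class M g) s = f s + g s"
    using rf(2) rg(2) by eventually_elim simp
  then show "vadd (L1_space M) (L1_class M f) (L1_class M g) = L1_class M (\<lambda>s. f s + g s)"
    using f g rf(1) rg(1) by (simp add: L1_space_def L1_class_eq_iff)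
  have "AE s in M. c *\<^sub>R L1_rep (L1_class M f) s = c *\<^sub>R f s"
    using rf(2) by eventually_elim simp
  then show "vscale (L1_space M) c (L1_class M f) = L1_class M (\<lambda>s. c *\<^sub>R f s)"
    using f rf(1) by (simp add: L1_space_def L1_class_eq_iff)
  have "AE s in M. norm (L1_rep (L1_class M f) s) = norm (f s)"
    using rf(2) by eventually_elim simp
  then show "vnorm (L1_space M) (L1_class M f) = (\<integral>s. norm (f s) \<partial>M)"
    using f rf(1) by (auto simp: L1_space_def intro!: integral_cong_AE)
qed

lemma integral_functional_class:
  fixes f :: "'s \<Rightarrow> 'e::euclidean_space"
  assumes "integrable M f"
  shows "integral_functional M \<phi> (L1_class M f) = ereal_integral M (\<lambda>s. \<phi> (f s))"
proof -
  note r = L1_rep_AE(2)[OF assms]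
  have "(\<integral>\<^sup>+ s. e2ennreal (\<phi> (L1_rep (L1_class M f) s)) \<partial>M) = (\<integral>\<^sup>+ s. e2ennreal (\<phi> (f s)) \<partial>M)"
    using r by (intro nn_integral_cong_AE) (auto elim!: AE_mp)
  moreover have "(\<integral>\<^sup>+ s. e2ennreal (- \<phi> (L1_rep (L1_class M f) s)) \<partial>M) = (\<integral>\<^sup>+ s. e2ennreal (- \<phi> (f s)) \<partial>M)"
    using r by (intro nn_integral_cong_AE) (auto elim!: AE_mp)
  ultimately show ?thesis
    by (simp add: integral_functional_def ereal_integral_def)
qed

end

theory Submission
  imports Defs
begin

text \<open>
  The conjugate is bounded on balls, hence \<open>\<phi> v \<ge> R * norm v - C\<close> for every \<open>R\<close> and some \<open>C\<close>, and
  the sublevel sets of the integral functional are equi-integrable; limits of the set functions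
  \<open>A \<mapsto> \<integral>\<^sub>A max 0 (\<plusminus> z \<bullet> b)\<close> along a filter on which they all converge have Radon--Nikodym densities, which
  provides weak cluster points. They stay in the sublevel set because \<open>\<phi>\<close> is a countable supremum of
  affine functions. Differentiability of the conjugate forces \<open>\<phi>\<close> to be strictly convex on its
  open domain, and then the midpoint gap \<open>\<phi> u / 2 + \<phi> x / 2 - \<phi> ((x + u) / 2)\<close> controls the
  distance of \<open>u\<close> from \<open>x\<close>. In the Kadec property the integrals of these gaps tend to \<open>0\<close> by weak
  lower semicontinuity, so a subsequence converges almost everywhere, and Fatou's lemma applied to
  \<open>\<phi> (u n) + C + norm x - norm (u n - x) \<ge> 0\<close> gives norm convergence.
\<close>

section \<open>Convex functions with differentiable conjugate\<close>

text \<open>Compactness here is topological, not sequential, so cluster points of arbitrary filters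
  are needed. Refining a filter until every eventually bounded real function converges treats all
  measurable sets and all directions at once; the limits are a priori only finitely additive in the
  set, and equi-integrability restores countable additivity. Differentiability of the conjugate
  enters twice: it contains finiteness everywhere, hence continuity of \<open>cjg\<close> and
  superlinear growth, and it makes the point that is tight at a given \<open>y\<close> unique.
  Openness of the domain gives a subgradient at every point of it, so strict convexity holds on the
  whole domain, and it makes \<open>rphi\<close> continuous at the values of the limit, so that
  convergence almost everywhere passes through \<open>rphi\<close>. In the Kadec property no fixed
  dominating function is at hand. Its role is taken by \<open>norm v \<le> rphi v + C\<close>, whose
  right side has converging integrals along the sequence.\<close>

locale differentiable_conjugate =
  fixes \<phi> :: "'e::euclidean_space \<Rightarrow> ereal"
  assumes proper: "proper_on UNIV \<phi>"
    and lsc: "lsc \<phi>"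
    and convex: "convex_ereal \<phi>"
    and open_domain: "open (effective_domain UNIV \<phi>)"
    and conjugate_differentiable: "\<forall>y. ereal_differentiable (fenchel_conjugate \<phi>) y"
begin

section \<open>Finite-valued forms of the function and its conjugate; growth and convexity\<close>

definition phidom :: "'e set" where "phidom = {v. \<phi> v < \<infinity>}"
text \<open>Outside \<open>phidom\<close> this takes the default value 0, so facts about
  \<open>rphi\<close> carry a domain hypothesis; \<open>cjg\<close> needs no such care, by
  \<open>conjugate_eq\<close>.\<close>

definition rphi :: "'e \<Rightarrow> real" where "rphi v = real_of_ereal (\<phi> v)"
definition cjg :: "'e \<Rightarrow> real" where "cjg y = real_of_ereal (fenchel_conjugate \<phi> y)"

lemma phi_not_minf: "\<phi> v \<noteq> -\<infinity>"
  using proper by (auto simp: proper_on_def)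

lemma open_phidom: "open phidom"
  using open_domain by (simp add: phidom_def effective_domain_def)

lemma phidom_nonempty: "\<exists>v. v \<in> phidom"
  using proper by (auto simp: proper_on_def phidom_def effective_domain_def)

lemma phi_dom: "v \<in> phidom \<Longrightarrow> \<phi> v = ereal (rphi v)"
  using phi_not_minf[of v] by (cases "\<phi> v") (auto simp: phidom_def rphi_def)

lemma phi_not_dom: "v \<notin> phidom \<Longrightarrow> \<phi> v = \<infinity>"
  by (auto simp: phidom_def)

lemma conjugate_eq: "fenchel_conjugate \<phi> y = ereal (cjg y)"
proof -
  have "ereal_differentiable (fenchel_conjugate \<phi>) y"
    using conjugate_differentiable by simp
  then have "\<forall>\<^sub>F z in nhds y. \<bar>fenchel_conjugate \<phi> z\<bar> \<noteq> \<infinity>"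
    by (simp add: ereal_differentiable_def)
  then have "\<bar>fenchel_conjugate \<phi> y\<bar> \<noteq> \<infinity>"
    by (rule eventually_nhds_x_imp_x)
  then obtain c where "fenchel_conjugate \<phi> y = ereal c"
    by (rule abs_neq_infinity_cases) auto
  then show ?thesis by (simp add: cjg_def)
qed

lemma cjg_differentiable: "cjg differentiable (at y)"
  using conjugate_differentiable unfolding ereal_differentiable_def cjg_def[abs_def] by blast

lemma cjg_continuous: "continuous_on S cjg"
  by (meson cjg_differentiable continuous_at_imp_continuous_on differentiable_imp_continuous_within)

lemma fenchel_young_dom:
  assumes "v \<in> phidom" shows "v \<bullet> y - cjg y \<le> rphi v"
proof -
  have "ereal (v \<bullet> y) - \<phi> v \<le> fenchel_conjugate \<phi> y"
    unfolding fenchel_conjugate_def by (rule SUP_upper) simp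
  then show ?thesis
    using phi_dom[OF assms] by (simp add: conjugate_eq)
qed

lemma fenchel_young: "ereal (v \<bullet> y - cjg y) \<le> \<phi> v"
  using fenchel_young_dom[of v y] phi_dom[of v] phi_not_dom[of v] by (cases "v \<in> phidom") auto

lemma cjg_le:
  assumes "\<And>v. v \<in> phidom \<Longrightarrow> v \<bullet> y - rphi v \<le> c"
  shows "cjg y \<le> c"
proof -
  have "fenchel_conjugate \<phi> y \<le> ereal c"
    unfolding fenchel_conjugate_def
  proof (rule SUP_least)
    fix v show "ereal (v \<bullet> y) - \<phi> v \<le> ereal c"
      using assms[of v] phi_dom[of v] phi_not_dom[of v] by (cases "v \<in> phidom") auto
  qed
  then show ?thesis by (simp add: conjugate_eq)
qed

lemma superlinear_growth:
  assumes "R \<ge> 0"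
  obtains C where "C \<ge> 0" "\<And>v. ereal (R * norm v - C) \<le> \<phi> v"
proof -
  have "compact (cjg ` cball 0 R)"
    by (intro compact_continuous_image cjg_continuous compact_cball)
  then obtain B where "\<forall>r\<in>cjg ` cball 0 R. norm r \<le> B"
    using compact_imp_bounded bounded_iff by metis
  then have B: "\<bar>cjg y\<bar> \<le> B" if "norm y \<le> R" for y
    using that by simp
  have "ereal (R * norm v - B) \<le> \<phi> v" for v
  proof -
    \<comment> \<open>For \<open>v \<noteq> 0\<close> this point of the ball maximises the inner
      product with \<open>v\<close>; for \<open>v = 0\<close> it is 0, which still lies in the
      ball.\<close>
    define y where "y = (R / norm v) *\<^sub>R v"
    have "norm y \<le> R" using assms by (simp add: y_def)
    moreover have "v \<bullet> y = R * norm v"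
      by (cases "v = 0") (auto simp: y_def dot_square_norm power2_eq_square)
    ultimately have "R * norm v - B \<le> v \<bullet> y - cjg y" using B[of y] by auto
    then show ?thesis using fenchel_young[of v y] by (meson ereal_less_eq(3) order_trans)
  qed
  moreover have "B \<ge> 0" using B[of 0] assms by auto
  ultimately show ?thesis using that by blast
qed

lemma convex_combination:
  assumes "x \<in> phidom" "u \<in> phidom" "0 < t" "t < 1"
  shows "(1 - t) *\<^sub>R x + t *\<^sub>R u \<in> phidom"
    and "rphi ((1 - t) *\<^sub>R x + t *\<^sub>R u) \<le> (1 - t) * rphi x + t * rphi u"
proof -
  have le: "\<phi> ((1 - t) *\<^sub>R x + t *\<^sub>R u) \<le> ereal (1 - t) * \<phi> x + ereal t * \<phi> u"
    using convex assms unfolding convex_ereal_def by blast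
  then show d: "(1 - t) *\<^sub>R x + t *\<^sub>R u \<in> phidom"
    using phi_dom[OF assms(1)] phi_dom[OF assms(2)] by (auto simp: phidom_def)
  show "rphi ((1 - t) *\<^sub>R x + t *\<^sub>R u) \<le> (1 - t) * rphi x + t * rphi u"
    using le phi_dom[OF d] phi_dom[OF assms(1)] phi_dom[OF assms(2)] by simp
qed

lemma convex_phidom: "convex phidom"
  unfolding convex_alt
  proof (intro ballI allI impI)
  fix x y and u :: real assume "x \<in> phidom" "y \<in> phidom" "0 \<le> u \<and> u \<le> 1"
  then show "(1 - u) *\<^sub>R x + u *\<^sub>R y \<in> phidom"
    using convex_combination(1)[of x y u] by (cases "u = 0 \<or> u = 1") auto
qed

lemma convex_on_rphi: "convex_on phidom rphi"
  by (intro convex_onI convex_combination(2) convex_phidom)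

lemma rphi_continuous: "continuous_on phidom rphi"
  by (rule convex_on_continuous[OF open_phidom convex_on_rphi])

section \<open>Lower semicontinuity, the epigraph and the biconjugate\<close>

lemma eventually_phi_greater:
  assumes "ereal t < \<phi> v"
  shows "eventually (\<lambda>u. ereal t < \<phi> u) (nhds v)"
proof -
  have "ereal t < Liminf (at v) \<phi>"
    using lsc assms unfolding lsc_def by (meson less_le_trans)
  then have "eventually (\<lambda>u. ereal t < \<phi> u) (at v)"
    by (rule less_LiminfD)
  \<comment> \<open>\<open>lsc\<close> speaks of the punctured neighbourhood only; the point
    \<open>v\<close> itself is supplied by the assumption.\<close>
  then show ?thesis
    using assms by (auto simp: eventually_at_filter elim!: eventually_mono)
qed

lemma borel_measurable_phi [measurable]: "\<phi> \<in> borel_measurable borel"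
proof (rule borel_measurableI_greater)
  fix a :: ereal
  have "open {u. a < \<phi> u}"
  proof (subst open_subopen, safe)
    fix v assume "a < \<phi> v"
    then obtain t where t: "a < ereal t" "ereal t < \<phi> v" using ereal_dense2 by blast
    from eventually_phi_greater[OF t(2)] obtain T where
      "open T" "v \<in> T" "\<And>u. u \<in> T \<Longrightarrow> ereal t < \<phi> u" by (auto simp: eventually_nhds)
    then show "\<exists>T. open T \<and> v \<in> T \<and> T \<subseteq> {u. a < \<phi> u}"
      using t(1) by (auto intro!: exI[of _ T] dest: less_trans)
  qed
  then show "{u \<in> space borel. a < \<phi> u} \<in> sets borel"
    by simp
qed

lemma closed_epigraph: "closed {(v, t). \<phi> v \<le> ereal t}"
proof -
  have "open (- {(v, t). \<phi> v \<le> ereal t})"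
  proof (subst open_subopen, intro ballI)
    fix z assume z: "z \<in> - {(v, t). \<phi> v \<le> ereal t}"
    obtain v t where vt: "z = (v, t)" by (cases z)
    then have "ereal t < \<phi> v" using z by simp
    \<comment> \<open>A level strictly between \<open>t\<close> and the value at \<open>v\<close>
      leaves room to move both coordinates.\<close>
    then obtain t' where t: "t < t'" "ereal t' < \<phi> v" using ereal_dense2 by fastforce
    from eventually_phi_greater[OF t(2)] obtain T where
      T: "open T" "v \<in> T" "\<And>u. u \<in> T \<Longrightarrow> ereal t' < \<phi> u" by (auto simp: eventually_nhds)
    have "T \<times> {..<t'} \<subseteq> - {(v, t). \<phi> v \<le> ereal t}"
    proof -
      have False if "u \<in> T" "r < t'" "\<phi> u \<le> ereal r" for u r
        using T(3)[of u] that by (cases "\<phi> u") auto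
      then show ?thesis by auto
    qed
    moreover have "open (T \<times> {..<t'})" using T by (intro open_Times) auto
    ultimately show "\<exists>T. open T \<and> z \<in> T \<and> T \<subseteq> - {(v, t). \<phi> v \<le> ereal t}"
      using T t vt by (intro exI[of _ "T \<times> {..<t'}"]) auto
  qed
  then show ?thesis by (simp add: closed_def)
qed

lemma convex_epigraph: "convex {(v, t). \<phi> v \<le> ereal t}"
proof -
  have *: "{(v, t). \<phi> v \<le> ereal t} = epigraph phidom rphi"
  proof (intro set_eqI, clarify)
    fix v t show "((v, t) \<in> {(v, t). \<phi> v \<le> ereal t}) = ((v, t) \<in> epigraph phidom rphi)"
      using phi_dom[of v] phi_not_dom[of v] by (cases "v \<in> phidom") (auto simp: epigraph_def)
  qed
  show ?thesis
    unfolding * by (simp add: convex_epigraph convex_on_rphi convex_phidom)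
qed

text \<open>The point \<open>(x, a)\<close> is strictly separated from the closed convex epigraph.
  If \<open>c > 0\<close>, the hyperplane is the graph of an affine minorant lying above
  \<open>a\<close> at \<open>x\<close>, and its slope is the required \<open>y\<close>. A vertical
  hyperplane (\<open>c = 0\<close>) only separates \<open>x\<close> from the domain and has to be
  combined with the constant minorant \<open>- cjg 0\<close>.\<close>

lemma biconjugate_approx:
  assumes a: "ereal a < \<phi> x"
  obtains y where "a < x \<bullet> y - cjg y"
proof -
  let ?E = "{(v, t). \<phi> v \<le> ereal t}"
  have "(x, a) \<notin> ?E" using a by auto
  then obtain w b where w: "w \<bullet> (x, a) < b" "\<forall>e\<in>?E. w \<bullet> e > b"
    using separating_hyperplane_closed_point[OF convex_epigraph closed_epigraph] by blast
  obtain p c where pc: "w = (p, c)" by (cases w)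
  have lo: "p \<bullet> x + c * a < b" using w(1) by (simp add: pc inner_prod_def)
  have up: "b < p \<bullet> v + c * t" if "v \<in> phidom" "rphi v \<le> t" for v t
    using w(2) that phi_dom[of v] by (force simp: pc inner_prod_def)
  obtain v0 where v0: "v0 \<in> phidom" using phidom_nonempty by blast
  have "c \<ge> 0"
  proof (rule ccontr)
    assume "\<not> c \<ge> 0"
    then have c: "c < 0" by simp
    \<comment> \<open>For negative \<open>c\<close> this height is in the epigraph above
      \<open>v0\<close> and brings the separating functional down to at most
      \<open>b\<close>.\<close>
    define t where "t = max (rphi v0) ((b - p \<bullet> v0) / c)"
    have "(b - p \<bullet> v0) / c \<le> t" by (simp add: t_def)
    then have "c * t \<le> b - p \<bullet> v0" using c by (simp add: field_simps)
    then show False using up[OF v0, of t] by (simp add: t_def)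
  qed
  then consider "c > 0" | "c = 0" by fastforce
  then show ?thesis
  proof cases
    case 1
    have "cjg (- (1 / c) *\<^sub>R p) \<le> - b / c"
    proof (rule cjg_le)
      fix v assume "v \<in> phidom"
      then show "v \<bullet> (- (1 / c) *\<^sub>R p) - rphi v \<le> - b / c"
      proof -
        have "b \<le> p \<bullet> v + c * rphi v" using up[of v "rphi v"] \<open>v \<in> phidom\<close> by simp
        then have "b / c \<le> (p \<bullet> v + c * rphi v) / c" using 1 by (intro divide_right_mono) auto
        also have "\<dots> = (p \<bullet> v) / c + rphi v" using 1 by (simp add: add_divide_distrib)
        finally show ?thesis by (simp add: inner_commute)
      qed
    qed
    moreover have "a < - (p \<bullet> x) / c + b / c" using lo 1 by (simp add: field_simps)
    ultimately show ?thesis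
      using that[of "- (1 / c) *\<^sub>R p"] by (simp add: inner_commute)
  next
    case 2
    \<comment> \<open>Adding \<open>k\<close> times \<open>b - p \<bullet> v\<close>, which is
      negative on the domain, to \<open>- cjg 0\<close> keeps a minorant; this \<open>k\<close>
      lifts it to at least \<open>a + 1\<close> at \<open>x\<close>.\<close>
    define k where "k = max 0 ((a + cjg 0 + 1) / (b - p \<bullet> x))"
    have bp: "b - p \<bullet> x > 0" using lo 2 by simp
    have k: "k \<ge> 0" "a + cjg 0 + 1 \<le> k * (b - p \<bullet> x)"
    proof -
      have "(a + cjg 0 + 1) / (b - p \<bullet> x) \<le> k" by (simp add: k_def)
      then show "a + cjg 0 + 1 \<le> k * (b - p \<bullet> x)" using bp by (simp add: pos_divide_le_eq)
    qed (simp add: k_def)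
    have "cjg (- k *\<^sub>R p) \<le> - k * b + cjg 0"
    proof (rule cjg_le)
      fix v assume v: "v \<in> phidom"
      have "k * b \<le> k * (p \<bullet> v)"
        using up[OF v order_refl] 2 k by (intro mult_left_mono) auto
      then show "v \<bullet> (- k *\<^sub>R p) - rphi v \<le> - k * b + cjg 0"
        using fenchel_young_dom[OF v, of 0] by (simp add: inner_commute)
    qed
    then show ?thesis
      using that[of "- k *\<^sub>R p"] k(2) by (simp add: inner_commute algebra_simps)
  qed
qed

text \<open>The condition on \<open>y\<close> in \<open>biconjugate_approx\<close> is open because
  \<open>cjg\<close> is continuous, so slopes from a countable dense set suffice. Countability is
  what allows monotone convergence for the finite maxima of these affine functions.\<close>

lemma countable_biconjugate:
  obtains q :: "nat \<Rightarrow> 'e" where "\<And>x a. ereal a < \<phi> x \<Longrightarrow> \<exists>k. a < x \<bullet> q k - cjg (q k)"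
proof -
  obtain D :: "'e set" where D: "countable D" "\<And>X. open X \<Longrightarrow> X \<noteq> {} \<Longrightarrow> \<exists>d\<in>D. d \<in> X"
    using countable_dense_setE by metis
  have ne: "D \<noteq> {}" using D(2)[of UNIV] by auto
  have "\<exists>k. a < x \<bullet> from_nat_into D k - cjg (from_nat_into D k)" if "ereal a < \<phi> x" for x a
  proof -
    obtain y where y: "a < x \<bullet> y - cjg y" using biconjugate_approx \<open>ereal a < \<phi> x\<close> by blast
    have "open {y. a < x \<bullet> y - cjg y}"
      by (intro open_Collect_less continuous_intros cjg_continuous)
    then obtain d where "d \<in> D" "a < x \<bullet> d - cjg d" using D(2) y by blast
    then show ?thesis by (metis D(1) from_nat_into_surj)
  qed
  then show ?thesis using that by blast
qed

text \<open>Near the interior point \<open>x\<close> of the domain \<open>\<phi>\<close> is bounded, so \<open>cjg y - x \<bullet> y\<close> is coercive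
  and the supremum in the biconjugate is attained.\<close>

lemma subgradient:
  assumes x: "x \<in> phidom"
  obtains y where "rphi x = x \<bullet> y - cjg y"
proof -
  obtain e where e: "e > 0" "cball x e \<subseteq> phidom"
    using open_phidom x open_contains_cball by blast
  have "compact (rphi ` cball x e)"
    by (intro compact_continuous_image continuous_on_subset[OF rphi_continuous e(2)] compact_cball)
  then obtain K where "\<forall>r\<in>rphi ` cball x e. norm r \<le> K"
    using compact_imp_bounded bounded_iff by metis
  then have K: "\<bar>rphi v\<bar> \<le> K" if "v \<in> cball x e" for v
    using that by simp
  have coercive: "x \<bullet> y + e * norm y - K \<le> cjg y" for y
  proof -
    define v where "v = x + (e / norm y) *\<^sub>R y"
    have v: "v \<in> cball x e" using e by (simp add: v_def dist_norm)
    have "v \<bullet> y = x \<bullet> y + e * norm y"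
      by (cases "y = 0") (auto simp: v_def inner_add_left dot_square_norm power2_eq_square)
    then show ?thesis using fenchel_young_dom[of v y] K[OF v] v e(2) by fastforce
  qed
  \<comment> \<open>Outside this radius \<open>coercive\<close> gives
    \<open>x \<bullet> z - cjg z \<le> rphi x - 1\<close>, so all nearly optimal slopes lie in the
    ball.\<close>
  define R where "R = max 0 ((K - rphi x + 1) / e)"
  have "compact (cball (0::'e) R)" "cball (0::'e) R \<noteq> {}" by (auto simp: R_def)
  moreover have "continuous_on (cball 0 R) (\<lambda>y. x \<bullet> y - cjg y)"
    by (intro continuous_intros cjg_continuous)
  ultimately obtain y where y: "\<And>z. z \<in> cball 0 R \<Longrightarrow> x \<bullet> z - cjg z \<le> x \<bullet> y - cjg y"
    using continuous_attains_sup[of "cball 0 R" "\<lambda>y. x \<bullet> y - cjg y"] by blast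
  have "rphi x \<le> x \<bullet> y - cjg y"
  proof (rule dense_ge)
    fix a' assume "x \<bullet> y - cjg y < a'"
    show "rphi x \<le> a'"
    proof (rule ccontr)
      \<comment> \<open>Keeping the level at or above \<open>rphi x - 1\<close> forces the slope
        \<open>z\<close> found below into the ball of radius \<open>R\<close>.\<close>
      define a where "a = max a' (rphi x - 1)"
      assume "\<not> rphi x \<le> a'"
      then have "ereal a < \<phi> x" by (simp add: phi_dom[OF x] a_def)
      then obtain z where z: "a < x \<bullet> z - cjg z" using biconjugate_approx by blast
      have "e * norm z < K - rphi x + 1" using coercive[of z] z by (simp add: a_def)
      then have "norm z < (K - rphi x + 1) / e" using e by (simp add: field_simps)
      then have "z \<in> cball 0 R" by (simp add: R_def)
      then show False using y[of z] z \<open>x \<bullet> y - cjg y < a'\<close> by (simp add: a_def)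
    qed
  qed
  then show ?thesis using that fenchel_young_dom[OF x, of y] by fastforce
qed

text \<open>A point at which the Fenchel--Young inequality is tight at \<open>y\<close> is the gradient of the
  conjugate at \<open>y\<close>.\<close>

lemma tight_unique:
  assumes "x \<in> phidom" "rphi x = x \<bullet> y - cjg y" "u \<in> phidom" "rphi u = u \<bullet> y - cjg y"
  shows "x = u"
proof -
  obtain D where D: "(cjg has_derivative D) (at y)"
    using cjg_differentiable differentiable_def by blast
  have *: "D = (\<lambda>h. x \<bullet> h)" if x: "x \<in> phidom" "rphi x = x \<bullet> y - cjg y" for x
  proof -
    have "((\<lambda>z. cjg z - x \<bullet> z) has_derivative (\<lambda>h. D h - x \<bullet> h)) (at y)"
      by (rule has_derivative_diff[OF D]) (auto intro!: derivative_eq_intros)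
    moreover have "cjg y - x \<bullet> y \<le> cjg z - x \<bullet> z" for z
      using fenchel_young_dom[OF x(1), of z] x(2) by simp
    ultimately have "(\<lambda>h. D h - x \<bullet> h) = (\<lambda>h. 0)"
      using differential_zero_maxmin[of y UNIV "\<lambda>z. cjg z - x \<bullet> z"] by blast
    then show ?thesis by (metis eq_iff_diff_eq_0)
  qed
  have "x \<bullet> h = u \<bullet> h" for h using *[OF assms(1,2)] *[OF assms(3,4)] by metis
  then show ?thesis by (meson vector_eq_rdot)
qed

text \<open>Take \<open>y\<close> tight at the intermediate point. The convexity gap is then exactly
  the weighted average of the Fenchel--Young deficits \<open>a\<close> of \<open>x\<close> and
  \<open>b\<close> of \<open>u\<close>, and both vanish only if \<open>x\<close> and
  \<open>u\<close> are tight at the same \<open>y\<close>, hence equal.\<close>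

lemma strictly_convex_rphi:
  assumes "x \<in> phidom" "u \<in> phidom" "x \<noteq> u" "0 < t" "t < 1"
  shows "rphi ((1 - t) *\<^sub>R x + t *\<^sub>R u) < (1 - t) * rphi x + t * rphi u"
proof -
  let ?w = "(1 - t) *\<^sub>R x + t *\<^sub>R u"
  obtain y where y: "rphi ?w = ?w \<bullet> y - cjg y"
    using subgradient convex_combination(1) assms by metis
  define a where "a = rphi x - (x \<bullet> y - cjg y)"
  define b where "b = rphi u - (u \<bullet> y - cjg y)"
  have ab: "a \<ge> 0" "b \<ge> 0" using fenchel_young_dom assms by (auto simp: a_def b_def)
  have "\<not> (a = 0 \<and> b = 0)" using tight_unique[of x y u] assms by (auto simp: a_def b_def)
  then have "(1 - t) * a + t * b > 0"
    using ab assms(4,5) by (smt (verit) mult_nonneg_nonneg mult_pos_pos)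
  also have "(1 - t) * a + t * b = (1 - t) * rphi x + t * rphi u - rphi ?w"
    unfolding y by (simp add: a_def b_def inner_add_left algebra_simps)
  finally show ?thesis by simp
qed

section \<open>The midpoint gap as a substitute for distance\<close>

definition midpoint_gap :: "'e \<Rightarrow> 'e \<Rightarrow> real" where
  "midpoint_gap x u = rphi u / 2 + rphi x / 2 - rphi ((1/2) *\<^sub>R (x + u))"

lemma midpoint_dom: "x \<in> phidom \<Longrightarrow> u \<in> phidom \<Longrightarrow> (1/2) *\<^sub>R (x + u) \<in> phidom"
  using convex_combination(1)[of x u "1/2"] by (simp add: algebra_simps)

lemma midpoint_gap_nonneg: "x \<in> phidom \<Longrightarrow> u \<in> phidom \<Longrightarrow> 0 \<le> midpoint_gap x u"
  using convex_combination(2)[of x u "1/2"] by (simp add: midpoint_gap_def algebra_simps)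

text \<open>Doubled, the claim compares values at the parameters \<open>s, 1/2, 1/2\<close> along
  the segment with those at \<open>s/2, s/2, 1\<close>. Both triples have the same sum, and
  \<open>s\<close> and \<open>1/2\<close> lie between \<open>s/2\<close> and \<open>1\<close>. So
  each is written as a convex combination of \<open>?p\<close> and \<open>x + d\<close>, and the
  weights of \<open>x + d\<close> add up to 1.\<close>

lemma midpoint_gap_mono:
  assumes x: "x \<in> phidom" and d: "x + d \<in> phidom" and s: "0 < s" "s < 1"
  shows "midpoint_gap x (x + s *\<^sub>R d) \<le> midpoint_gap x (x + d)"
proof -
  let ?p = "x + (s/2) *\<^sub>R d" let ?w = "1 - s/2"
  have w: "?w > 0" using s by simp
  have pd: "?p \<in> phidom"
    using convex_combination(1)[of x "x + d" "s/2"] assms by (simp add: algebra_simps)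
  have mid: "(1/2) *\<^sub>R (x + (x + h)) = x + (1/2) *\<^sub>R h" for h
  proof -
    have "(1/2) *\<^sub>R (x + (x + h)) = (1/2) *\<^sub>R (x + x) + (1/2) *\<^sub>R h"
      by (simp add: scaleR_add_right)
    then show ?thesis by (simp only: scaleR_half_double)
  qed
  have e1: "(1 - (s/2)/?w) *\<^sub>R ?p + ((s/2)/?w) *\<^sub>R (x + d) = x + s *\<^sub>R d"
  proof -
    have "(1 - (s/2)/?w) *\<^sub>R ?p + ((s/2)/?w) *\<^sub>R (x + d)
        = x + ((1 - (s/2)/?w) * (s/2) + (s/2)/?w) *\<^sub>R d"
      by (simp add: algebra_simps)
    also have "(1 - (s/2)/?w) * (s/2) + (s/2)/?w = s"
      using w by (simp add: divide_simps) algebra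
    finally show ?thesis .
  qed
  have e2: "(1 - ((1-s)/2)/?w) *\<^sub>R ?p + (((1-s)/2)/?w) *\<^sub>R (x + d) = (1/2) *\<^sub>R (x + (x + d))"
  proof -
    have "(1 - ((1-s)/2)/?w) *\<^sub>R ?p + (((1-s)/2)/?w) *\<^sub>R (x + d)
        = x + ((1 - ((1-s)/2)/?w) * (s/2) + ((1-s)/2)/?w) *\<^sub>R d"
      by (simp add: algebra_simps)
    also have "(1 - ((1-s)/2)/?w) * (s/2) + ((1-s)/2)/?w = 1/2"
      using w by (simp add: divide_simps) algebra
    finally show ?thesis unfolding mid .
  qed
  have b1: "rphi (x + s *\<^sub>R d) \<le> (1 - (s/2)/?w) * rphi ?p + ((s/2)/?w) * rphi (x + d)"
    using convex_combination(2)[OF pd d, of "(s/2)/?w"] s w unfolding e1 by (simp add: divide_simps)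
  have b2: "rphi ((1/2) *\<^sub>R (x + (x + d))) \<le>
      (1 - ((1-s)/2)/?w) * rphi ?p + (((1-s)/2)/?w) * rphi (x + d)"
    using convex_combination(2)[OF pd d, of "((1-s)/2)/?w"] s w unfolding e2 by (simp add: divide_simps)
  have c: "(s/2)/?w + 2 * (((1-s)/2)/?w) = 1"
  proof -
    have "(s/2)/z + 2 * (((1-s)/2)/z) = (s/2 + (1 - s))/z" for z
      by (cases "z = 0") (simp_all add: field_simps)
    then have "(s/2)/?w + 2 * (((1-s)/2)/?w) = (s/2 + (1 - s))/?w" .
    also have "s/2 + (1 - s) = ?w" by simp
    finally show ?thesis using w by simp
  qed
  have "rphi (x + s *\<^sub>R d) + 2 * rphi ((1/2) *\<^sub>R (x + (x + d)))
      \<le> (3 - ((s/2)/?w + 2 * (((1-s)/2)/?w))) * rphi ?p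
        + ((s/2)/?w + 2 * (((1-s)/2)/?w)) * rphi (x + d)"
    using b1 b2 by (simp only: algebra_simps)
  then have "rphi (x + s *\<^sub>R d) + 2 * rphi ((1/2) *\<^sub>R (x + (x + d))) \<le> 2 * rphi ?p + rphi (x + d)"
    unfolding c by simp
  moreover have "(1/2) *\<^sub>R (x + (x + s *\<^sub>R d)) = ?p"
    unfolding mid by simp
  ultimately show ?thesis unfolding midpoint_gap_def by simp
qed

text \<open>Strict convexity and compactness give a positive minimum on a small sphere around
  \<open>x\<close>, and \<open>midpoint_gap_mono\<close> carries it outward along rays. The constant
  \<delta> depends on \<open>x\<close>, which is enough for convergence almost everywhere.\<close>

lemma midpoint_gap_separates:
  assumes x: "x \<in> phidom" and "\<epsilon> > 0"
  obtains \<delta> where "\<delta> > 0" "\<And>u. u \<in> phidom \<Longrightarrow> norm (u - x) \<ge> \<epsilon> \<Longrightarrow> midpoint_gap x u \<ge> \<delta>"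
proof -
  obtain e0 where e0: "e0 > 0" "cball x e0 \<subseteq> phidom"
    using open_phidom x open_contains_cball by blast
  \<comment> \<open>Half of \<epsilon> makes the sphere strictly smaller than the distances
    considered, so that \<open>s < 1\<close> below.\<close>
  define e where "e = min (\<epsilon>/2) e0"
  have e: "e > 0" "e < \<epsilon>" "sphere x e \<subseteq> phidom"
    using e0 assms by (auto simp: e_def subset_eq)
  have "continuous_on (sphere x e) (midpoint_gap x)"
    unfolding midpoint_gap_def[abs_def]
  proof (intro continuous_on_add continuous_on_diff continuous_on_divide continuous_on_const
      continuous_on_subset[OF rphi_continuous e(3)])
    show "continuous_on (sphere x e) (\<lambda>u. rphi ((1/2) *\<^sub>R (x + u)))"
      by (rule continuous_on_compose2[OF rphi_continuous])
        (use midpoint_dom x e(3) in \<open>auto intro!: continuous_on_scaleR continuous_on_add continuous_on_const continuous_on_id\<close>)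
  qed auto
  moreover have ne: "sphere x e \<noteq> {}" using e by simp
  ultimately obtain u0 where u0: "u0 \<in> sphere x e"
      "\<And>u. u \<in> sphere x e \<Longrightarrow> midpoint_gap x u0 \<le> midpoint_gap x u"
    using continuous_attains_inf[OF compact_sphere, of x e "midpoint_gap x"] by blast
  have "x \<noteq> u0" using u0(1) e by auto
  then have "midpoint_gap x u0 > 0"
    using strictly_convex_rphi[OF x, of u0 "1/2"] u0(1) e(3)
    by (auto simp: midpoint_gap_def algebra_simps)
  moreover have "midpoint_gap x u0 \<le> midpoint_gap x u" if u: "u \<in> phidom" "norm (u - x) \<ge> \<epsilon>" for u
  proof -
    define s where "s = e / norm (u - x)"
    have s: "0 < s" "s < 1" using e u assms by (auto simp: s_def divide_simps)
    have "x + s *\<^sub>R (u - x) \<in> sphere x e" using e u by (auto simp: s_def dist_norm)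
    then have "midpoint_gap x u0 \<le> midpoint_gap x (x + s *\<^sub>R (u - x))" by (rule u0(2))
    also have "\<dots> \<le> midpoint_gap x (x + (u - x))"
      using x s u by (intro midpoint_gap_mono) auto
    finally show ?thesis by simp
  qed
  ultimately show ?thesis using that by blast
qed

end

section \<open>Set functions, filters and weak topologies\<close>

text \<open>A limit of set functions is a priori only finitely additive. The \<epsilon>-\<delta>
  condition survives such limits and gives continuity at the empty set, hence countable additivity,
  as well as the absolute continuity required by Radon--Nikodym.\<close>

lemma (in finite_measure) additive_set_function_density:
  fixes \<nu> :: "'a set \<Rightarrow> real"
  assumes nonneg: "\<And>A. A \<in> sets M \<Longrightarrow> 0 \<le> \<nu> A"
    and additive: "\<And>A B. A \<in> sets M \<Longrightarrow> B \<in> sets M \<Longrightarrow> A \<inter> B = {} \<Longrightarrow> \<nu> (A \<union> B) = \<nu> A + \<nu> B"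
    and abs_cont: "\<And>\<epsilon>. \<epsilon> > 0 \<Longrightarrow> \<exists>\<delta>>0. \<forall>A\<in>sets M. measure M A < \<delta> \<longrightarrow> \<nu> A \<le> \<epsilon>"
  obtains f where "integrable M f" "\<And>x. 0 \<le> f x"
    "\<And>A. A \<in> sets M \<Longrightarrow> \<nu> A = (LINT x:A|M. f x)"
proof -
  have empty: "\<nu> {} = 0" using additive[of "{}" "{}"] by simp
  let ?n = "\<lambda>A. ennreal (\<nu> A)"
  have pos: "positive (sets M) ?n" by (simp add: positive_def empty)
  have add: "additive (sets M) ?n" by (auto simp: Measure_Space.additive_def additive nonneg)
  have ca: "countably_additive (sets M) ?n"
  proof (rule sets.empty_continuous_imp_countably_additive[OF pos add])
    fix A :: "nat \<Rightarrow> 'a set" assume A: "range A \<subseteq> sets M" "decseq A" "(\<Inter>i. A i) = {}"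
    have lim: "(\<lambda>n. measure M (A n)) \<longlonglongrightarrow> 0"
      using finite_Lim_measure_decseq[OF A(1,2)] A(3) by simp
    have "(\<lambda>n. \<nu> (A n)) \<longlonglongrightarrow> 0"
    proof (rule LIMSEQ_I)
      fix r :: real assume r: "0 < r"
      then obtain \<delta> where \<delta>: "\<delta> > 0" "\<forall>A\<in>sets M. measure M A < \<delta> \<longrightarrow> \<nu> A \<le> r/2"
        using abs_cont[of "r/2"] by auto
      obtain n0 where "\<And>n. n \<ge> n0 \<Longrightarrow> measure M (A n) < \<delta>"
        using LIMSEQ_D[OF lim \<delta>(1)] by auto
      then show "\<exists>no. \<forall>n\<ge>no. norm (\<nu> (A n) - 0) < r"
        using \<delta>(2) nonneg A(1) r by (intro exI[of _ n0]) (force simp: image_subset_iff)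
    qed
    then show "(\<lambda>n. ?n (A n)) \<longlonglongrightarrow> 0" using tendsto_ennrealI by fastforce
  qed simp
  define N where "N = measure_of (space M) (sets M) ?n"
  have sN: "sets N = sets M" "space N = space M" by (simp_all add: N_def)
  have eN: "emeasure N A = ?n A" if "A \<in> sets M" for A
    unfolding N_def using sets.sigma_algebra_axioms pos ca that by (rule emeasure_measure_of_sigma)
  have "absolutely_continuous M N"
    unfolding absolutely_continuous_def
  proof
    fix A assume A: "A \<in> null_sets M"
    then have A': "A \<in> sets M" "measure M A = 0" by (auto simp: measure_def)
    have "\<nu> A \<le> 0"
    proof (rule field_le_epsilon)
      fix e :: real assume "e > 0"
      then show "\<nu> A \<le> 0 + e" using abs_cont[of e] A' by auto
    qed
    then show "A \<in> null_sets N" using A' eN[of A] by (simp add: null_sets_def sN ennreal_neg)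
  qed
  then obtain f where f: "f \<in> borel_measurable M" "density M f = N"
    using Radon_Nikodym sN(1) by blast
  have int: "(\<integral>\<^sup>+x. f x * indicator A x \<partial>M) = ?n A" if "A \<in> sets M" for A
    using eN[OF that] emeasure_density[OF f(1) that] unfolding f(2) by simp
  have fin: "(\<integral>\<^sup>+x. f x \<partial>M) \<noteq> \<infinity>"
  proof -
    have "(\<integral>\<^sup>+x. f x \<partial>M) = (\<integral>\<^sup>+x. f x * indicator (space M) x \<partial>M)"
      by (intro nn_integral_cong) auto
    then show ?thesis using int[of "space M"] by simp
  qed
  then have AE_fin: "AE x in M. f x \<noteq> \<infinity>" using f(1) by (intro nn_integral_PInf_AE)
  \<comment> \<open>The density may be infinite on a null set, where \<open>enn2real\<close>
    replaces it by 0.\<close>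
  define g where "g x = enn2real (f x)" for x
  have gm: "g \<in> borel_measurable M" using f(1) by (simp add: g_def[abs_def])
  have g0: "0 \<le> g x" for x by (simp add: g_def)
  have gAE: "AE x in M. ennreal (g x) = f x"
    using AE_fin by eventually_elim (simp add: g_def less_top)
  have gint: "(\<integral>\<^sup>+x. ennreal (indicator A x * g x) \<partial>M) = ?n A" if "A \<in> sets M" for A
    unfolding int[OF that, symmetric]
    by (intro nn_integral_cong_AE) (use gAE in eventually_elim, auto split: split_indicator)
  have i: "integrable M (\<lambda>x. indicator A x * g x)" if "A \<in> sets M" for A
    using gint[OF that] gm that g0
    by (intro integrableI_nonneg) auto
  have "integrable M g"
    using i[OF sets.top] by (simp cong: Bochner_Integration.integrable_cong)
  moreover have "\<nu> A = (LINT x:A|M. g x)" if "A \<in> sets M" for A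
    using gint[OF that] nonneg[OF that] gm that g0
    by (simp add: set_lebesgue_integral_def integral_eq_nn_integral)
  ultimately show ?thesis using that g0 by blast
qed

text \<open>A substitute for ultrafilters: by Tychonoff's theorem the points
  \<open>(h z)\<close>, indexed by the bounded functions \<open>h\<close>, have a cluster point.\<close>

lemma universal_subfilter:
  fixes F :: "'v filter"
  assumes "F \<noteq> bot"
  obtains G where "G \<le> F" "G \<noteq> bot"
    "\<And>h :: 'v \<Rightarrow> real. \<And>B. eventually (\<lambda>z. \<bar>h z\<bar> \<le> B) F \<Longrightarrow> \<exists>l. (h \<longlongrightarrow> l) G"
proof -
  \<comment> \<open>A bound depending on \<open>h\<close> alone is fixed, because the cube below
    needs one interval per function.\<close>
  obtain b where b: "\<And>(h::'v \<Rightarrow> real) B. eventually (\<lambda>z. \<bar>h z\<bar> \<le> B) F \<Longrightarrow> eventually (\<lambda>z. \<bar>h z\<bar> \<le> b h) F"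
  proof
    fix h :: "'v \<Rightarrow> real" and B assume "eventually (\<lambda>z. \<bar>h z\<bar> \<le> B) F"
    then show "eventually (\<lambda>z. \<bar>h z\<bar> \<le> (SOME B. eventually (\<lambda>z. \<bar>h z\<bar> \<le> B) F)) F"
      by (rule someI[of "\<lambda>B. eventually (\<lambda>z. \<bar>h z\<bar> \<le> B) F"])
  qed
  \<comment> \<open>Values beyond the bound are replaced by 0, so every \<open>J z\<close> lies in
    the cube; coordinates belonging to eventually bounded \<open>h\<close> are eventually unchanged
    along \<open>F\<close>.\<close>
  define J :: "'v \<Rightarrow> ('v \<Rightarrow> real) \<Rightarrow> real" where
    "J z h = (if \<bar>h z\<bar> \<le> b h then h z else 0)" for z h
  \<comment> \<open>The absolute value keeps the interval nonempty when \<open>h\<close> is not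
    eventually bounded and \<open>b h\<close> is arbitrary.\<close>
  define C where "C = PiE UNIV (\<lambda>h::'v \<Rightarrow> real. {- \<bar>b h\<bar>..\<bar>b h\<bar>})"
  have "compactin (product_topology (\<lambda>_. euclidean) UNIV) C"
    unfolding C_def by (subst compactin_PiE) (simp add: compact_Icc)
  then have "compact C" by (simp add: euclidean_product_topology)
  moreover have JC: "J z \<in> C" for z by (auto simp: C_def J_def)
  then have "eventually (\<lambda>\<theta>. \<theta> \<in> C) (filtermap J F)" by (simp add: eventually_filtermap)
  moreover have "filtermap J F \<noteq> bot" using assms by (simp add: filtermap_bot_iff)
  ultimately obtain \<theta> where \<theta>: "inf (nhds \<theta>) (filtermap J F) \<noteq> bot"
    unfolding compact_filter by blast
  \<comment> \<open>This is the coarsest refinement of \<open>F\<close> along which \<open>J\<close>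
    tends to \<open>\<theta>\<close>; convergence in the product is convergence of every
    coordinate.\<close>
  define G where "G = inf (filtercomap J (nhds \<theta>)) F"
  have "G \<noteq> bot"
  proof
    assume "G = bot"
    then have "eventually (\<lambda>_. False) G" by simp
    then obtain P Q where PQ: "eventually P (filtercomap J (nhds \<theta>))" "eventually Q F"
        "\<And>z. P z \<Longrightarrow> Q z \<Longrightarrow> False"
      unfolding G_def eventually_inf by blast
    obtain P' where P': "eventually P' (nhds \<theta>)" "\<And>z. P' (J z) \<Longrightarrow> P z"
      using PQ(1) unfolding eventually_filtercomap by blast
    have "eventually (\<lambda>y. \<not> P' y) (filtermap J F)"
      unfolding eventually_filtermap using PQ(2) by eventually_elim (use PQ(3) P'(2) in blast)
    then have "eventually (\<lambda>_. False) (inf (nhds \<theta>) (filtermap J F))"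
      unfolding eventually_inf using P'(1) by blast
    then show False using \<theta> by (simp add: trivial_limit_def)
  qed
  moreover have "G \<le> F" by (simp add: G_def)
  moreover have "\<exists>l. (h \<longlongrightarrow> l) G" if "eventually (\<lambda>z. \<bar>h z\<bar> \<le> B) F" for h :: "'v \<Rightarrow> real" and B
  proof -
    have "(J \<longlongrightarrow> \<theta>) G"
      unfolding filterlim_iff_le_filtercomap G_def by simp
    then have "((\<lambda>z. J z h) \<longlongrightarrow> \<theta> h) G"
    proof -
      assume J: "(J \<longlongrightarrow> \<theta>) G"
      show ?thesis
      proof (rule topological_tendstoI)
        fix V :: "real set" assume V: "open V" "\<theta> h \<in> V"
        have "open ((\<lambda>\<theta>. \<theta> h) -` V)"
          by (rule open_vimage[OF V(1)]) simp
        then show "eventually (\<lambda>z. J z h \<in> V) G"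
          using topological_tendstoD[OF J] V(2) by fastforce
      qed
    qed
    moreover have "eventually (\<lambda>z. J z h = h z) F"
      using b[OF that] by eventually_elim (simp add: J_def)
    then have "eventually (\<lambda>z. J z h = h z) G" using \<open>G \<le> F\<close> by (rule filter_leD[rotated])
    ultimately have "(h \<longlongrightarrow> \<theta> h) G" by (blast intro: Lim_transform_eventually)
    then show ?thesis by blast
  qed
  ultimately show ?thesis using that by blast
qed

section \<open>Weak topologies through filters\<close>

lemma topspace_weak_topology: "topspace (weak_topology X) = vcarrier X"
proof -
  have "(\<lambda>_. 0) \<in> dual_space X" by (auto simp: dual_space_def intro: exI[of _ 0])
  then have "\<exists>\<Lambda> U. vcarrier X = {x \<in> vcarrier X. \<Lambda> x \<in> U} \<and> \<Lambda> \<in> dual_space X \<and> open U"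
    by (intro exI[of _ "\<lambda>_. 0"] exI[of _ UNIV]) auto
  then show ?thesis unfolding weak_topology_def topology_generated_by_topspace by blast
qed

text \<open>Weakly open sets arise from the generators by finite intersections and unions, and both
  operations preserve the claim. Each generator is cut out of the carrier, hence the assumption that
  the filter eventually lives there.\<close>

lemma eventually_in_weakly_open:
  assumes "openin (weak_topology X) U" "x \<in> U"
    and "eventually (\<lambda>z. z \<in> vcarrier X) F" "\<And>\<Lambda>. \<Lambda> \<in> dual_space X \<Longrightarrow> (\<Lambda> \<longlongrightarrow> \<Lambda> x) F"
  shows "eventually (\<lambda>z. z \<in> U) F"
proof -
  have "generate_topology_on {{x \<in> vcarrier X. \<Lambda> x \<in> U} | \<Lambda> U. \<Lambda> \<in> dual_space X \<and> open U} U"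
    using assms(1) unfolding weak_topology_def by (rule openin_topology_generated_by)
  then show ?thesis using assms(2)
  proof induction
    case (Int a b)
    then show ?case by (auto intro: eventually_conj)
  next
    case (UN K)
    then obtain k where "k \<in> K" "x \<in> k" by blast
    with UN have "eventually (\<lambda>z. z \<in> k) F" by blast
    then show ?case by eventually_elim (use \<open>k \<in> K\<close> in blast)
  next
    case (Basis s)
    then obtain \<Lambda> V where s: "s = {x \<in> vcarrier X. \<Lambda> x \<in> V}" "\<Lambda> \<in> dual_space X" "open V" by blast
    then have "eventually (\<lambda>z. \<Lambda> z \<in> V) F"
      using Basis.prems topological_tendstoD[OF assms(4)] by blast
    then show ?case using assms(3) by eventually_elim (simp add: s)
  qed simp
qed

lemma limitin_weak_topologyD:
  assumes "limitin (weak_topology X) u x F" "\<Lambda> \<in> dual_space X"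
  shows "((\<lambda>n. \<Lambda> (u n)) \<longlongrightarrow> \<Lambda> x) F"
proof (rule topological_tendstoI)
  fix V assume "open V" "\<Lambda> x \<in> V"
  have "openin (weak_topology X) {x \<in> vcarrier X. \<Lambda> x \<in> V}"
    unfolding weak_topology_def using \<open>open V\<close> assms(2) by (intro topology_generated_by_Basis) blast
  moreover have "x \<in> vcarrier X"
    using limitin_topspace[OF assms(1)] by (simp add: topspace_weak_topology)
  ultimately have "eventually (\<lambda>n. u n \<in> {x \<in> vcarrier X. \<Lambda> x \<in> V}) F"
    using assms(1) \<open>\<Lambda> x \<in> V\<close> unfolding limitin_def by blast
  then show "eventually (\<lambda>n. \<Lambda> (u n) \<in> V) F" by eventually_elim simp
qed

text \<open>For closed sets whose finite intersections meet \<open>K\<close>, the filter generated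
  by \<open>K\<close> and these sets is proper. A cluster point in \<open>K\<close> belongs to each
  of them, since otherwise a complement would be a weak neighbourhood that the filter eventually
  avoids.\<close>

lemma compactin_weak_topologyI:
  assumes K: "K \<subseteq> vcarrier X"
    and cluster: "\<And>F. F \<noteq> bot \<Longrightarrow> eventually (\<lambda>z. z \<in> K) F \<Longrightarrow>
      \<exists>G x. G \<le> F \<and> G \<noteq> bot \<and> x \<in> K \<and> (\<forall>\<Lambda>\<in>dual_space X. (\<Lambda> \<longlongrightarrow> \<Lambda> x) G)"
  shows "compactin (weak_topology X) K"
  unfolding compactin_fip
proof (intro conjI allI impI)
  show "K \<subseteq> topspace (weak_topology X)" using K by (simp add: topspace_weak_topology)
  fix \<U>
  assume \<U>: "(\<forall>C\<in>\<U>. closedin (weak_topology X) C) \<and>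
    (\<forall>\<F>. finite \<F> \<and> \<F> \<subseteq> \<U> \<longrightarrow> K \<inter> \<Inter>\<F> \<noteq> {})"
  define F where "F = inf (principal K) (INF C\<in>\<U>. principal C)"
  have "F \<noteq> bot"
  proof
    assume "F = bot"
    then have "eventually (\<lambda>_. False) F" by simp
    then obtain P Q where PQ: "\<And>z. z \<in> K \<Longrightarrow> P z" "eventually Q (INF C\<in>\<U>. principal C)"
        "\<And>z. P z \<Longrightarrow> Q z \<Longrightarrow> False"
      unfolding F_def eventually_inf eventually_principal by blast
    then obtain \<F> where \<F>: "\<F> \<subseteq> \<U>" "finite \<F>" "eventually Q (INF C\<in>\<F>. principal C)"
      unfolding eventually_INF[of _ _ \<U>] by blast
    then have "\<forall>z\<in>\<Inter>\<F>. Q z"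
      using INF_principal_finite[of \<F> "\<lambda>C. C"] by (simp add: eventually_principal)
    then show False using PQ \<U> \<F> by blast
  qed
  moreover have FK: "eventually (\<lambda>z. z \<in> K) F"
    unfolding F_def by (rule filter_leD[OF inf_le1]) (simp add: eventually_principal)
  ultimately obtain G x where G: "G \<le> F" "G \<noteq> bot" "x \<in> K" "\<forall>\<Lambda>\<in>dual_space X. (\<Lambda> \<longlongrightarrow> \<Lambda> x) G"
    using cluster by blast
  have "x \<in> C" if "C \<in> \<U>" for C
  proof (rule ccontr)
    assume "x \<notin> C"
    then have x: "x \<in> vcarrier X - C" using G(3) K by blast
    have "openin (weak_topology X) (vcarrier X - C)"
      using \<U> that topspace_weak_topology by (metis closedin_def)
    moreover have "eventually (\<lambda>z. z \<in> vcarrier X) G"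
      using filter_leD[OF G(1) FK] by eventually_elim (use K in blast)
    ultimately have "eventually (\<lambda>z. z \<in> vcarrier X - C) G"
      using x G(4) by (intro eventually_in_weakly_open) auto
    moreover have "eventually (\<lambda>z. z \<in> C) F"
      unfolding F_def
      by (rule filter_leD[OF order_trans[OF inf_le2 INF_lower[OF that]]]) (simp add: eventually_principal)
    then have "eventually (\<lambda>z. z \<in> C) G" using G(1) by (rule filter_leD[rotated])
    ultimately have "eventually (\<lambda>_. False) G" by eventually_elim simp
    then show False using G(2) by (simp add: trivial_limit_def)
  qed
  then show "K \<inter> \<Inter>\<U> \<noteq> {}" using G(3) by blast
qed

section \<open>Duality and weak limits in \<open>L\<^sup>1\<close>\<close>

text \<open>Adding \<open>B * measure M A\<close> makes the set function nonnegative and bounded by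
  \<open>2 * B * measure M A\<close>. Its density is therefore at most \<open>2 * B\<close> almost
  everywhere, and subtracting \<open>B\<close> returns to \<open>\<nu>\<close>.\<close>

lemma (in finite_measure) bounded_additive_set_function_density:
  fixes \<nu> :: "'a set \<Rightarrow> real"
  assumes additive: "\<And>A C. A \<in> sets M \<Longrightarrow> C \<in> sets M \<Longrightarrow> A \<inter> C = {} \<Longrightarrow> \<nu> (A \<union> C) = \<nu> A + \<nu> C"
    and bound: "\<And>A. A \<in> sets M \<Longrightarrow> \<bar>\<nu> A\<bar> \<le> B * measure M A" and "B \<ge> 0"
  obtains h where "h \<in> borel_measurable M" "\<And>x. \<bar>h x\<bar> \<le> B"
    "\<And>A. A \<in> sets M \<Longrightarrow> \<nu> A = (LINT x:A|M. h x)"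
proof -
  define \<kappa> where "\<kappa> A = \<nu> A + B * measure M A" for A
  have k: "0 \<le> \<kappa> A" "\<kappa> A \<le> 2 * B * measure M A" if "A \<in> sets M" for A
    using bound[OF that] by (auto simp: \<kappa>_def)
  obtain f where f: "integrable M f" "\<And>x. 0 \<le> f x"
      "\<And>A. A \<in> sets M \<Longrightarrow> \<kappa> A = (LINT x:A|M. f x)"
  proof (rule additive_set_function_density)
    show "\<exists>\<delta>>0. \<forall>A\<in>sets M. measure M A < \<delta> \<longrightarrow> \<kappa> A \<le> \<epsilon>" if "\<epsilon> > 0" for \<epsilon>
    \<comment> \<open>The summand 1 keeps the denominator positive when
      \<open>B = 0\<close>.\<close>
    proof (intro exI[of _ "\<epsilon> / (2 * B + 1)"] conjI ballI impI)
      show "0 < \<epsilon> / (2 * B + 1)" using that \<open>B \<ge> 0\<close> by simp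
      fix A assume A: "A \<in> sets M" "measure M A < \<epsilon> / (2 * B + 1)"
      have "\<kappa> A \<le> (2 * B + 1) * measure M A"
        using k(2)[OF A(1)] measure_nonneg[of M A] unfolding distrib_right by linarith
      also have "\<dots> \<le> \<epsilon>" using A(2) \<open>B \<ge> 0\<close> by (simp add: field_simps)
      finally show "\<kappa> A \<le> \<epsilon>" .
    qed
  qed (use k additive finite_measure_Union in \<open>auto simp: \<kappa>_def algebra_simps\<close>)
  have int_f: "integrable M (\<lambda>x. indicator A x * f x)" if "A \<in> sets M" for A
    using integrable_mult_indicator[OF that f(1)] by simp
  have int_diff: "(LINT x|M. indicator A x * (f x - c)) = (LINT x:A|M. f x) - c * measure M A"
    if A: "A \<in> sets M" for A c
  proof -
    have "integrable M (\<lambda>x. indicator A x * c)" using A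
      by (intro integrable_mult_left integrable_real_indicator) (simp_all add: less_top[symmetric])
    then have "(LINT x|M. indicator A x * f x - indicator A x * c) = (LINT x:A|M. f x) - (LINT x|M. indicator A x * c)"
      using int_f[OF A] by (simp add: set_lebesgue_integral_def)
    then show ?thesis using A by (simp add: right_diff_distrib mult.commute)
  qed
  \<comment> \<open>Here the excess over \<open>2 * B\<close> is positive, yet its integral is at
    most 0 by the bound on \<open>\<kappa>\<close>; so the set is null.\<close>
  define D where "D = {x \<in> space M. 2 * B < f x}"
  have fm [measurable]: "f \<in> borel_measurable M" using f(1) by auto
  have D: "D \<in> sets M" unfolding D_def by measurable
  have i: "integrable M (\<lambda>x. indicator D x * (f x - 2 * B))"
    using integrable_mult_indicator[OF D, of "\<lambda>x. f x - 2 * B"] f(1) by simp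
  have n: "0 \<le> indicator D x * (f x - 2 * B)" for x by (auto simp: D_def indicator_def)
  have "(LINT x|M. indicator D x * (f x - 2 * B)) = \<kappa> D - 2 * B * measure M D"
    using int_diff[OF D] f(3)[OF D] by simp
  moreover have "0 \<le> (LINT x|M. indicator D x * (f x - 2 * B))"
    using n by (rule Bochner_Integration.integral_nonneg)
  ultimately have "(LINT x|M. indicator D x * (f x - 2 * B)) = 0"
    using k(2)[OF D] by linarith
  then have "AE x in M. indicator D x * (f x - 2 * B) = 0"
    using integral_nonneg_eq_0_iff_AE[OF i] n by simp
  then have le: "AE x in M. f x \<le> 2 * B"
    using AE_space by eventually_elim (auto simp: D_def split: split_indicator_asm)
  \<comment> \<open>Truncation changes the density on a null set only and makes the bound hold at
    every point.\<close>
  define h where "h x = min (f x) (2 * B) - B" for x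
  have hm [measurable]: "h \<in> borel_measurable M" unfolding h_def[abs_def] by measurable
  have "\<bar>h x\<bar> \<le> B" for x using f(2)[of x] \<open>B \<ge> 0\<close> by (auto simp: h_def)
  moreover have "\<nu> A = (LINT x:A|M. h x)" if A: "A \<in> sets M" for A
  proof -
    have "(LINT x:A|M. h x) = (LINT x|M. indicator A x * (f x - B))"
      unfolding set_lebesgue_integral_def using A
      by (intro integral_cong_AE) (use le in \<open>auto simp: h_def\<close>)
    also have "\<dots> = \<kappa> A - B * measure M A"
      using int_diff[OF A] f(3)[OF A] by simp
    finally show ?thesis by (simp add: \<kappa>_def)
  qed
  ultimately show ?thesis using that hm by blast
qed

text \<open>For a basis vector \<open>b\<close>, the functional applied to
  \<open>indicator A\<close> times \<open>b\<close> is additive in \<open>A\<close> and bounded by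
  \<open>B * measure M A\<close>; its density is the \<open>b\<close>-coordinate of
  \<open>g\<close>. Both sides agree on indicators and are continuous in the norm, so they agree on
  all integrable functions.\<close>

lemma L1_dual_representation:
  fixes \<Lambda> :: "('s \<Rightarrow> 'e::euclidean_space) set \<Rightarrow> real"
  assumes "finite_measure M" and \<Lambda>: "\<Lambda> \<in> dual_space (L1_space M)"
  obtains g B where "g \<in> borel_measurable M" "\<And>s. norm (g s) \<le> B"
    "\<And>f. integrable M f \<Longrightarrow> \<Lambda> (L1_class M f) = (LINT s|M. g s \<bullet> f s)"
proof -
  interpret finite_measure M by fact
  define L where "L f = \<Lambda> (L1_class M f)" for f
  have add: "L (\<lambda>s. f s + g s) = L f + L g" if "integrable M f" "integrable M g" for f g
  proof -
    have "\<forall>x\<in>vcarrier (L1_space M). \<forall>y\<in>vcarrier (L1_space M). \<Lambda> (vadd (L1_space M) x y) = \<Lambda> x + \<Lambda> y"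
      using \<Lambda> by (simp add: dual_space_def)
    then show ?thesis using L1_space_simps[OF that] L1_space_simps(1)[OF that(2,1)] unfolding L_def by metis
  qed
  have scale: "L (\<lambda>s. c *\<^sub>R f s) = c * L f" if "integrable M f" for f c
  proof -
    have "\<forall>c. \<forall>x\<in>vcarrier (L1_space M). \<Lambda> (vscale (L1_space M) c x) = c * \<Lambda> x"
      using \<Lambda> by (simp add: dual_space_def)
    then show ?thesis using L1_space_simps[OF that that] unfolding L_def by metis
  qed
  obtain B0 where B0: "\<forall>x\<in>vcarrier (L1_space M). \<bar>\<Lambda> x\<bar> \<le> B0 * vnorm (L1_space M) x"
    using \<Lambda> by (auto simp: dual_space_def)
  define B where "B = \<bar>B0\<bar>"
  have bound: "\<bar>L f\<bar> \<le> B * (LINT s|M. norm (f s))" if "integrable M f" for f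
  proof -
    have "\<bar>L f\<bar> \<le> B0 * (LINT s|M. norm (f s))"
      using B0 L1_space_simps[OF that that] by (auto simp: L_def)
    also have "\<dots> \<le> B * (LINT s|M. norm (f s))"
      by (intro mult_right_mono) (auto simp: B_def)
    finally show ?thesis .
  qed
  have int_ind: "integrable M (\<lambda>s. indicator A s *\<^sub>R c)" if "A \<in> sets M" for A and c :: 'e
    using that
    by (intro integrable_scaleR_left integrable_real_indicator) (simp_all add: less_top[symmetric])
  have "\<exists>h. h \<in> borel_measurable M \<and> (\<forall>s. \<bar>h s\<bar> \<le> B) \<and>
      (\<forall>A\<in>sets M. L (\<lambda>s. indicator A s *\<^sub>R b) = (LINT s:A|M. h s))" if b: "b \<in> Basis" for b :: 'e
  proof -
    obtain h where "h \<in> borel_measurable M" "\<And>s. \<bar>h s\<bar> \<le> B"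
      "\<And>A. A \<in> sets M \<Longrightarrow> L (\<lambda>s. indicator A s *\<^sub>R b) = (LINT s:A|M. h s)"
    proof (rule bounded_additive_set_function_density[of "\<lambda>A. L (\<lambda>s. indicator A s *\<^sub>R b)" B])
      fix A C assume AC: "A \<in> sets M" "C \<in> sets M" "A \<inter> C = {}"
      have "(\<lambda>s. indicator (A \<union> C) s *\<^sub>R b) = (\<lambda>s. indicator A s *\<^sub>R b + indicator C s *\<^sub>R b)"
        using AC(3) by (auto simp: indicator_def fun_eq_iff)
      then show "L (\<lambda>s. indicator (A \<union> C) s *\<^sub>R b) = L (\<lambda>s. indicator A s *\<^sub>R b) + L (\<lambda>s. indicator C s *\<^sub>R b)"
        using add int_ind AC by simp
    next
      fix A assume A: "A \<in> sets M"
      have "(LINT s|M. norm (indicator A s *\<^sub>R b)) = measure M A"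
        using A b by simp
      then show "\<bar>L (\<lambda>s. indicator A s *\<^sub>R b)\<bar> \<le> B * measure M A"
        using bound[OF int_ind[OF A, of b]] by simp
    qed (auto simp: B_def)
    then show ?thesis by blast
  qed
  then obtain h where h: "\<And>b. b \<in> Basis \<Longrightarrow> h b \<in> borel_measurable M"
      "\<And>b s. b \<in> Basis \<Longrightarrow> \<bar>h b s\<bar> \<le> B"
      "\<And>b A. b \<in> Basis \<Longrightarrow> A \<in> sets M \<Longrightarrow> L (\<lambda>s. indicator A s *\<^sub>R b) = (LINT s:A|M. h b s)"
    by metis
  define g :: "'s \<Rightarrow> 'e" where "g s = (\<Sum>b\<in>Basis. h b s *\<^sub>R b)" for s
  have gm [measurable]: "g \<in> borel_measurable M"
    unfolding g_def[abs_def] using h(1) by (intro borel_measurable_sum borel_measurable_scaleR) auto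
  have gb: "g s \<bullet> b = h b s" if "b \<in> Basis" for b s
    using that by (simp add: g_def inner_sum_left_Basis)
  define K where "K = real DIM('e) * B"
  have gK: "norm (g s) \<le> K" for s
  proof -
    have "norm (g s) \<le> (\<Sum>b\<in>Basis. \<bar>g s \<bullet> b\<bar>)" by (rule norm_le_l1)
    also have "\<dots> \<le> (\<Sum>b\<in>(Basis::'e set). B)" using gb h(2) by (intro sum_mono) simp
    finally show ?thesis by (simp add: K_def)
  qed
  have gs: "norm (g s \<bullet> v) \<le> K * norm v" for s v
    using order_trans[OF Cauchy_Schwarz_ineq2[of "g s" v] mult_right_mono[OF gK[of s] norm_ge_zero[of v]]]
    by simp
  have int_g: "integrable M (\<lambda>s. g s \<bullet> f s)" if "integrable M f" for f
  proof (rule Bochner_Integration.integrable_bound)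
    show "integrable M (\<lambda>s. K * norm (f s))" using that by simp
    show "AE s in M. norm (g s \<bullet> f s) \<le> norm (K * norm (f s))"
      by (rule AE_I2) (rule order_trans[OF gs], simp)
  qed (use that in measurable)
  have "L f = (LINT s|M. g s \<bullet> f s)" if "integrable M f" for f
    using that
  proof (induction rule: integrable_induct)
    case (base A c)
    have sum_L: "L (\<lambda>s. \<Sum>b\<in>T. (c \<bullet> b) *\<^sub>R (indicator A s *\<^sub>R b)) =
        (\<Sum>b\<in>T. (c \<bullet> b) * L (\<lambda>s. indicator A s *\<^sub>R b))" if "finite T" for T
      using that
    proof induction
      case empty
      then show ?case using scale[of "\<lambda>s. 0" 0] by simp
    next
      case (insert b T)
      have "integrable M (\<lambda>s. (c \<bullet> b) *\<^sub>R (indicator A s *\<^sub>R b))"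
           "integrable M (\<lambda>s. \<Sum>b\<in>T. (c \<bullet> b) *\<^sub>R (indicator A s *\<^sub>R b))"
        by (intro Bochner_Integration.integrable_sum integrable_scaleR_right int_ind base(1))+
      then show ?case
        using insert add[of "\<lambda>s. (c \<bullet> b) *\<^sub>R (indicator A s *\<^sub>R b)"
            "\<lambda>s. \<Sum>b\<in>T. (c \<bullet> b) *\<^sub>R (indicator A s *\<^sub>R b)"] scale[OF int_ind[OF base(1), of b], of "c \<bullet> b"]
        by simp
    qed
    have "indicator A s *\<^sub>R c = (\<Sum>b\<in>Basis. (c \<bullet> b) *\<^sub>R (indicator A s *\<^sub>R b))" for s
      by (cases "s \<in> A") (auto simp: euclidean_representation)
    then have "L (\<lambda>s. indicator A s *\<^sub>R c) = (\<Sum>b\<in>Basis. (c \<bullet> b) * (LINT s:A|M. h b s))"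
      using sum_L[OF finite_Basis] h(3)[OF _ base(1)] by simp
    also have "\<dots> = (\<Sum>b\<in>Basis. (LINT s|M. (c \<bullet> b) * (indicator A s * h b s)))"
      by (simp add: set_lebesgue_integral_def)
    also have "\<dots> = (LINT s|M. (\<Sum>b\<in>Basis. (c \<bullet> b) * (indicator A s * h b s)))"
    proof (rule Bochner_Integration.integral_sum[symmetric])
      fix b :: 'e assume b: "b \<in> Basis"
      have "integrable M (\<lambda>s. g s \<bullet> (indicator A s *\<^sub>R b))" by (intro int_g int_ind base)
      then show "integrable M (\<lambda>s. (c \<bullet> b) * (indicator A s * h b s))"
        using gb[OF b] by simp
    qed
    also have "\<dots> = (LINT s|M. g s \<bullet> (indicator A s *\<^sub>R c))"
    proof (rule Bochner_Integration.integral_cong[OF refl])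
      fix s
      have "g s \<bullet> c = (\<Sum>b\<in>Basis. (g s \<bullet> b) * (c \<bullet> b))" by (rule euclidean_inner)
      also have "\<dots> = (\<Sum>b\<in>Basis. (c \<bullet> b) * h b s)" by (simp add: gb mult.commute)
      finally show "(\<Sum>b\<in>Basis. (c \<bullet> b) * (indicator A s * h b s)) = g s \<bullet> (indicator A s *\<^sub>R c)"
        by (cases "s \<in> A") auto
    qed
    finally show ?case .
  next
    case (add f1 f2)
    then show ?case
      using \<open>\<And>f g. integrable M f \<Longrightarrow> integrable M g \<Longrightarrow> L (\<lambda>s. f s + g s) = L f + L g\<close> int_g
      by (simp add: inner_add_right)
  next
    case (lim f u)
    have "(\<lambda>i. LINT s|M. norm (u i s - f s)) \<longlonglongrightarrow> (LINT s|M. 0)"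
    proof (rule integral_dominated_convergence)
      \<comment> \<open>The induction rule provides approximants with norm at most
        \<open>2 * norm (f s)\<close>; the difference adds one more.\<close>
      show "integrable M (\<lambda>s. 3 * norm (f s))" using lim by simp
      show "AE s in M. (\<lambda>i. norm (u i s - f s)) \<longlonglongrightarrow> 0"
        using lim.hyps(2) by (auto intro!: AE_I2 tendsto_norm_zero LIM_zero)
      show "AE s in M. norm (norm (u i s - f s)) \<le> 3 * norm (f s)" for i
      proof (rule AE_I2)
        fix s assume "s \<in> space M"
        then show "norm (norm (u i s - f s)) \<le> 3 * norm (f s)"
          using lim.hyps(3)[of s i] norm_triangle_ineq4[of "u i s" "f s"] by simp
      qed
    qed (use lim in measurable)
    then have null: "(\<lambda>i. LINT s|M. norm (u i s - f s)) \<longlonglongrightarrow> 0" by simp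
    have diff: "L (u i) - L f = L (\<lambda>s. u i s - f s)" for i
      using add[of "u i" "\<lambda>s. (-1) *\<^sub>R f s"] scale[of f "-1"] lim by simp
    have "(\<lambda>i. L (u i) - L f) \<longlonglongrightarrow> 0"
    proof (rule Lim_null_comparison)
      show "eventually (\<lambda>i. norm (L (u i) - L f) \<le> B * (LINT s|M. norm (u i s - f s))) sequentially"
        using bound lim diff by (intro always_eventually) simp
      show "(\<lambda>i. B * (LINT s|M. norm (u i s - f s))) \<longlonglongrightarrow> 0"
        using tendsto_mult_right_zero[OF null] by simp
    qed
    then have "(\<lambda>i. L (u i)) \<longlonglongrightarrow> L f" by (rule LIM_zero_cancel)
    moreover have "(\<lambda>i. (LINT s|M. g s \<bullet> u i s) - (LINT s|M. g s \<bullet> f s)) \<longlonglongrightarrow> 0"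
    proof (rule Lim_null_comparison)
      have "norm ((LINT s|M. g s \<bullet> u i s) - (LINT s|M. g s \<bullet> f s)) \<le> K * (LINT s|M. norm (u i s - f s))" for i
      proof -
        have d: "integrable M (\<lambda>s. u i s - f s)" using lim by simp
        have "(LINT s|M. g s \<bullet> u i s) - (LINT s|M. g s \<bullet> f s) = (LINT s|M. g s \<bullet> (u i s - f s))"
          using lim int_g by (simp add: inner_diff_right)
        also have "norm \<dots> \<le> (LINT s|M. norm (g s \<bullet> (u i s - f s)))"
          by (rule Bochner_Integration.integral_norm_bound)
        also have "\<dots> \<le> (LINT s|M. K * norm (u i s - f s))"
          using d int_g gs by (intro Bochner_Integration.integral_mono integrable_norm integrable_mult_right) auto
        finally show ?thesis by simp
      qed
      then show "eventually (\<lambda>i. norm ((LINT s|M. g s \<bullet> u i s) - (LINT s|M. g s \<bullet> f s)) \<le> K * (LINT s|M. norm (u i s - f s))) sequentially"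
        by simp
      show "(\<lambda>i. K * (LINT s|M. norm (u i s - f s))) \<longlonglongrightarrow> 0"
        using tendsto_mult_right_zero[OF null] by simp
    qed
    then have "(\<lambda>i. LINT s|M. g s \<bullet> u i s) \<longlonglongrightarrow> (LINT s|M. g s \<bullet> f s)" by (rule LIM_zero_cancel)
    ultimately show ?case using lim.IH LIMSEQ_unique by simp
  qed
  then show ?thesis using that[OF gm gK] by (simp add: L_def)
qed

text \<open>Positive parts are used because densities are available for nonnegative set functions.
  The limit density \<open>f b\<close> need not be the positive part of
  \<open>x s \<bullet> b\<close>; only the difference of the densities for \<open>b\<close> and
  \<open>- b\<close> matters, and it is the coordinate of the limit.\<close>

lemma (in finite_measure) weak_limit_exists:
  fixes z :: "'i \<Rightarrow> 'a \<Rightarrow> 'e::euclidean_space"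
  assumes "G \<noteq> bot" and int: "eventually (\<lambda>i. integrable M (z i)) G"
    and ui: "\<And>\<epsilon>. \<epsilon> > 0 \<Longrightarrow> \<exists>\<delta>>0. \<forall>A\<in>sets M. measure M A < \<delta> \<longrightarrow>
      eventually (\<lambda>i. (LINT s:A|M. norm (z i s)) \<le> \<epsilon>) G"
    and lim: "\<And>A b. A \<in> sets M \<Longrightarrow> \<exists>l. ((\<lambda>i. LINT s:A|M. max 0 (z i s \<bullet> b)) \<longlongrightarrow> l) G"
  obtains x where "integrable M x"
    "\<And>A b. A \<in> sets M \<Longrightarrow> b \<in> Basis \<Longrightarrow> ((\<lambda>i. LINT s:A|M. z i s \<bullet> b) \<longlongrightarrow> (LINT s:A|M. x s \<bullet> b)) G"
proof -
  have set_int: "set_integrable M A f" if "integrable M f" "A \<in> sets M" for A and f :: "'a \<Rightarrow> real"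
    using integrable_mult_indicator[OF that(2,1)] by (simp add: set_integrable_def)
  have int_pos: "integrable M (\<lambda>s. max 0 (y s \<bullet> b))" if "integrable M y" for y :: "'a \<Rightarrow> 'e" and b
    using that by (intro integrable_max) auto
  have "\<exists>f. integrable M f \<and> (\<forall>A\<in>sets M. ((\<lambda>i. LINT s:A|M. max 0 (z i s \<bullet> c)) \<longlongrightarrow> (LINT s:A|M. f s)) G)"
    if c: "norm c \<le> 1" for c
  proof -
    obtain \<nu> where \<nu>: "\<And>A. A \<in> sets M \<Longrightarrow> ((\<lambda>i. LINT s:A|M. max 0 (z i s \<bullet> c)) \<longlongrightarrow> \<nu> A) G"
      using lim[of _ c] by metis
    obtain f where "integrable M f" "\<And>x. 0 \<le> f x" "\<And>A. A \<in> sets M \<Longrightarrow> \<nu> A = (LINT x:A|M. f x)"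
    proof (rule additive_set_function_density)
      fix A assume A: "A \<in> sets M"
      show "0 \<le> \<nu> A"
        by (rule tendsto_lowerbound[OF \<nu>[OF A] always_eventually \<open>G \<noteq> bot\<close>])
          (auto simp: set_lebesgue_integral_def)
    next
      fix A C assume AC: "A \<in> sets M" "C \<in> sets M" "A \<inter> C = {}"
      have "eventually (\<lambda>i. (LINT s:A|M. max 0 (z i s \<bullet> c)) + (LINT s:C|M. max 0 (z i s \<bullet> c))
          = (LINT s:A \<union> C|M. max 0 (z i s \<bullet> c))) G"
        using int
        by eventually_elim (use AC in \<open>auto intro!: set_integral_Un[symmetric] set_int int_pos\<close>)
      then have "((\<lambda>i. LINT s:A \<union> C|M. max 0 (z i s \<bullet> c)) \<longlongrightarrow> \<nu> A + \<nu> C) G"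
        by (rule Lim_transform_eventually[OF tendsto_add[OF \<nu> \<nu>], rotated 2]) (use AC in auto)
      then show "\<nu> (A \<union> C) = \<nu> A + \<nu> C"
        using tendsto_unique[OF \<open>G \<noteq> bot\<close> \<nu>] AC by blast
    next
      fix \<epsilon> :: real assume "\<epsilon> > 0"
      then obtain \<delta> where \<delta>: "\<delta> > 0" "\<And>A. A \<in> sets M \<Longrightarrow> measure M A < \<delta> \<Longrightarrow>
          eventually (\<lambda>i. (LINT s:A|M. norm (z i s)) \<le> \<epsilon>) G"
        using ui by blast
      have "\<nu> A \<le> \<epsilon>" if A: "A \<in> sets M" "measure M A < \<delta>" for A
      proof (rule tendsto_upperbound[OF \<nu>[OF A(1)] _ \<open>G \<noteq> bot\<close>])
        show "eventually (\<lambda>i. (LINT s:A|M. max 0 (z i s \<bullet> c)) \<le> \<epsilon>) G"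
          using \<delta>(2)[OF A] int
        proof eventually_elim
          case (elim i)
          have "(LINT s:A|M. max 0 (z i s \<bullet> c)) \<le> (LINT s:A|M. norm (z i s))"
          proof (rule set_integral_mono)
            show "max 0 (z i s \<bullet> c) \<le> norm (z i s)" for s
              using norm_cauchy_schwarz[of "z i s" c] mult_left_mono[OF c norm_ge_zero[of "z i s"]] by auto
          qed (use elim A in \<open>auto intro!: set_int int_pos\<close>)
          then show ?case using elim by simp
        qed
      qed
      then show "\<exists>\<delta>>0. \<forall>A\<in>sets M. measure M A < \<delta> \<longrightarrow> \<nu> A \<le> \<epsilon>" using \<delta>(1) by blast
    qed blast
    then show ?thesis using \<nu> by metis
  qed
  then obtain f where f: "\<And>c. norm c \<le> 1 \<Longrightarrow> integrable M (f c)"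
    "\<And>c A. norm c \<le> 1 \<Longrightarrow> A \<in> sets M \<Longrightarrow>
      ((\<lambda>i. LINT s:A|M. max 0 (z i s \<bullet> c)) \<longlongrightarrow> (LINT s:A|M. f c s)) G"
    by metis
  define x where "x s = (\<Sum>b\<in>Basis. (f b s - f (- b) s) *\<^sub>R b)" for s
  have "integrable M x"
    unfolding x_def[abs_def]
    by (intro Bochner_Integration.integrable_sum integrable_scaleR_left Bochner_Integration.integrable_diff f) auto
  moreover have "((\<lambda>i. LINT s:A|M. z i s \<bullet> b) \<longlongrightarrow> (LINT s:A|M. x s \<bullet> b)) G"
    if A: "A \<in> sets M" and b: "b \<in> Basis" for A b
  proof -
    have n: "norm b \<le> 1" "norm (- b) \<le> 1" using b by auto
    have "x s \<bullet> b = f b s - f (- b) s" for s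
      using b by (simp add: x_def inner_sum_left_Basis)
    then have e: "(LINT s:A|M. x s \<bullet> b) = (LINT s:A|M. f b s) - (LINT s:A|M. f (- b) s)"
      using set_integral_diff(2)[OF set_int[OF f(1)[OF n(1)] A] set_int[OF f(1)[OF n(2)] A]] by simp
    have "eventually (\<lambda>i. (LINT s:A|M. max 0 (z i s \<bullet> b)) - (LINT s:A|M. max 0 (z i s \<bullet> (- b)))
        = (LINT s:A|M. z i s \<bullet> b)) G"
      using int
    proof eventually_elim
      case (elim i)
      have "(LINT s:A|M. z i s \<bullet> b) = (LINT s:A|M. max 0 (z i s \<bullet> b) - max 0 (z i s \<bullet> (- b)))"
        unfolding set_lebesgue_integral_def
        by (intro Bochner_Integration.integral_cong) (auto simp: max_def)
      also have "\<dots> = (LINT s:A|M. max 0 (z i s \<bullet> b)) - (LINT s:A|M. max 0 (z i s \<bullet> (- b)))"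
        by (rule set_integral_diff(2)[OF set_int[OF int_pos[OF elim] A] set_int[OF int_pos[OF elim] A]])
      finally show ?case by simp
    qed
    then show ?thesis
      unfolding e by (rule Lim_transform_eventually[rotated]) (intro tendsto_diff f n A)
  qed
  ultimately show ?thesis using that by blast
qed

lemma integrable_bounded_mult:
  fixes h f :: "'a \<Rightarrow> real"
  assumes "integrable M f" "h \<in> borel_measurable M" "\<And>s. \<bar>h s\<bar> \<le> B"
  shows "integrable M (\<lambda>s. h s * f s)"
proof (rule Bochner_Integration.integrable_bound)
  show "integrable M (\<lambda>s. B * f s)" using assms(1) by simp
  show "AE s in M. norm (h s * f s) \<le> norm (B * f s)"
    using assms(3) by (intro AE_I2) (simp add: abs_mult mult_right_mono order_trans[OF _ abs_ge_self])
qed (use assms in measurable)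

text \<open>Convergence of the integrals over all measurable sets extends to bounded multipliers by
  rounding \<open>h\<close> to the grid \<open>\<int> / n\<close>.\<close>

lemma (in finite_measure) tendsto_integral_bounded_mult:
  fixes y :: "'i \<Rightarrow> 'a \<Rightarrow> real"
  assumes int: "eventually (\<lambda>i. integrable M (y i)) G"
    and bound: "eventually (\<lambda>i. (LINT s|M. \<bar>y i s\<bar>) \<le> C) G"
    and w: "integrable M w" and h [measurable]: "h \<in> borel_measurable M" and hB: "\<And>s. \<bar>h s\<bar> \<le> B"
    and conv: "\<And>A. A \<in> sets M \<Longrightarrow> ((\<lambda>i. LINT s:A|M. y i s) \<longlongrightarrow> (LINT s:A|M. w s)) G"
  shows "((\<lambda>i. LINT s|M. h s * y i s) \<longlongrightarrow> (LINT s|M. h s * w s)) G"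
proof (rule tendstoI)
  fix e :: real assume e: "e > 0"
  \<comment> \<open>Rounding \<open>h\<close> by at most \<open>1 / n\<close> costs at most
    \<open>W / n\<close> for the integrals against \<open>y i\<close> and \<open>w\<close> together,
    and \<open>n\<close> makes this less than half of the tolerance.\<close>
  define W where "W = \<bar>C\<bar> + (LINT s|M. \<bar>w s\<bar>)"
  have W: "W \<ge> 0" by (simp add: W_def)
  obtain n :: nat where n: "2 * W / e < real n" using reals_Archimedean2 by blast
  have n0: "0 < real n" using n W e by (smt (verit) divide_nonneg_pos)
  have nW: "W / n < e / 2" using n n0 e by (simp add: field_simps)
  define k where "k s = \<lfloor>h s * n\<rfloor>" for s
  define A where "A j = {s \<in> space M. k s = j}" for j
  have [measurable]: "k \<in> measurable M (count_space UNIV)" unfolding k_def[abs_def] by measurable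
  have A: "A j \<in> sets M" for j unfolding A_def by measurable
  \<comment> \<open>Boundedness of \<open>h\<close> leaves finitely many grid values, so the rounded
    integral is a finite combination of set integrals.\<close>
  define m where "m = \<lceil>B * n\<rceil>"
  have km: "k s \<in> {-m..m}" for s
  proof -
    have "\<bar>h s * n\<bar> \<le> B * n" using hB n0 by (simp add: abs_mult)
    then have "h s * n \<le> m" "- m \<le> h s * n" by (auto simp: m_def) linarith+
    then show ?thesis by (auto simp: k_def) linarith+
  qed
  have kh: "\<bar>h s - k s / n\<bar> \<le> 1 / n" for s
  proof -
    have "\<bar>h s * n - k s\<bar> \<le> 1" unfolding k_def by linarith
    then have "\<bar>h s * n - k s\<bar> / n \<le> 1 / n" using n0 by (intro divide_right_mono) auto
    moreover have "h s - k s / n = (h s * n - k s) / n" using n0 by (simp add: field_simps)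
    ultimately show ?thesis by simp
  qed
  have grid: "(LINT s|M. (k s / n) * f s) = (\<Sum>j\<in>{-m..m}. (j / n) * (LINT s:A j|M. f s))"
    and grid_int: "integrable M (\<lambda>s. (k s / n) * f s)" if f: "integrable M f" for f
  proof -
    have p: "(k s / n) * f s = (\<Sum>j\<in>{-m..m}. (j / n) * (indicator (A j) s * f s))"
      if "s \<in> space M" for s
    proof -
      have "(\<Sum>j\<in>{-m..m}. (j / n) * (indicator (A j) s * f s))
          = (\<Sum>j\<in>{-m..m}. if j = k s then (k s / n) * f s else 0)"
        using that by (intro sum.cong) (auto simp: A_def indicator_def)
      then show ?thesis using km[of s] by simp
    qed
    have i: "integrable M (\<lambda>s. indicator (A j) s * f s)" for j
      using integrable_mult_indicator[OF A f] by simp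
    have "integrable M (\<lambda>s. \<Sum>j\<in>{-m..m}. (j / n) * (indicator (A j) s * f s))"
      using i by (intro Bochner_Integration.integrable_sum integrable_mult_right)
    then show "integrable M (\<lambda>s. (k s / n) * f s)"
      using p by (simp cong: Bochner_Integration.integrable_cong)
    have "(LINT s|M. (k s / n) * f s) = (LINT s|M. (\<Sum>j\<in>{-m..m}. (j / n) * (indicator (A j) s * f s)))"
      using p by (intro Bochner_Integration.integral_cong) auto
    also have "\<dots> = (\<Sum>j\<in>{-m..m}. (LINT s|M. (j / n) * (indicator (A j) s * f s)))"
      using i by (intro Bochner_Integration.integral_sum integrable_mult_right)
    finally show "(LINT s|M. (k s / n) * f s) = (\<Sum>j\<in>{-m..m}. (j / n) * (LINT s:A j|M. f s))"
      by (simp add: set_lebesgue_integral_def)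
  qed
  have approx: "\<bar>(LINT s|M. h s * f s) - (LINT s|M. (k s / n) * f s)\<bar> \<le> (LINT s|M. \<bar>f s\<bar>) / n"
    if f: "integrable M f" for f
  proof -
    have ih: "integrable M (\<lambda>s. h s * f s)" by (rule integrable_bounded_mult[OF f h hB])
    have "(LINT s|M. h s * f s) - (LINT s|M. (k s / n) * f s) = (LINT s|M. (h s - k s / n) * f s)"
      using Bochner_Integration.integral_diff[OF ih grid_int[OF f]] by (simp add: left_diff_distrib)
    also have "norm \<dots> \<le> (LINT s|M. norm ((h s - k s / n) * f s))"
      by (rule Bochner_Integration.integral_norm_bound)
    also have "\<dots> \<le> (LINT s|M. (1 / n) * \<bar>f s\<bar>)"
    proof (rule Bochner_Integration.integral_mono)
      show "integrable M (\<lambda>s. norm ((h s - k s / n) * f s))"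
        using Bochner_Integration.integrable_diff[OF ih grid_int[OF f]]
        by (intro integrable_norm) (simp add: left_diff_distrib)
      show "norm ((h s - k s / n) * f s) \<le> (1 / n) * \<bar>f s\<bar>" for s
        using mult_right_mono[OF kh[of s], of "\<bar>f s\<bar>"] by (simp add: abs_mult)
    qed (use f in auto)
    finally show ?thesis by simp
  qed
  have "((\<lambda>i. \<Sum>j\<in>{-m..m}. (j / n) * (LINT s:A j|M. y i s)) \<longlongrightarrow>
      (\<Sum>j\<in>{-m..m}. (j / n) * (LINT s:A j|M. w s))) G"
    by (intro tendsto_sum tendsto_mult tendsto_const conv A)
  then have "eventually (\<lambda>i. dist (\<Sum>j\<in>{-m..m}. (j / n) * (LINT s:A j|M. y i s))
      (\<Sum>j\<in>{-m..m}. (j / n) * (LINT s:A j|M. w s)) < e / 2) G"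
    using e by (intro tendstoD) auto
  then show "eventually (\<lambda>i. dist (LINT s|M. h s * y i s) (LINT s|M. h s * w s) < e) G"
    using int bound
  proof eventually_elim
    case (elim i)
    have "dist (LINT s|M. (k s / n) * y i s) (LINT s|M. (k s / n) * w s) < e / 2"
      using elim(1) grid[OF elim(2)] grid[OF w] by simp
    moreover have "\<bar>(LINT s|M. h s * y i s) - (LINT s|M. (k s / n) * y i s)\<bar> \<le> \<bar>C\<bar> / n"
    proof (rule order_trans[OF approx[OF elim(2)] divide_right_mono])
      show "(LINT s|M. \<bar>y i s\<bar>) \<le> \<bar>C\<bar>" using elim(3) by linarith
    qed simp
    moreover note approx[OF w]
    moreover have "\<bar>C\<bar> / n + (LINT s|M. \<bar>w s\<bar>) / n < e / 2"
      using nW by (simp add: W_def add_divide_distrib)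
    ultimately show ?case unfolding dist_real_def by linarith
  qed
qed

lemma (in finite_measure) tendsto_integral_bounded_inner:
  fixes z :: "'i \<Rightarrow> 'a \<Rightarrow> 'e::euclidean_space"
  assumes int: "eventually (\<lambda>i. integrable M (z i)) G"
    and bound: "eventually (\<lambda>i. (LINT s|M. norm (z i s)) \<le> C) G"
    and x: "integrable M x" and g: "g \<in> borel_measurable M" and gB: "\<And>s. norm (g s) \<le> B"
    and conv: "\<And>A b. A \<in> sets M \<Longrightarrow> b \<in> Basis \<Longrightarrow>
      ((\<lambda>i. LINT s:A|M. z i s \<bullet> b) \<longlongrightarrow> (LINT s:A|M. x s \<bullet> b)) G"
  shows "((\<lambda>i. LINT s|M. g s \<bullet> z i s) \<longlongrightarrow> (LINT s|M. g s \<bullet> x s)) G"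
proof -
  have gb: "(\<lambda>s. g s \<bullet> b) \<in> borel_measurable M" "\<bar>g s \<bullet> b\<bar> \<le> B" if "b \<in> Basis" for b s
    using g Basis_le_norm[OF that, of "g s"] gB[of s] by (auto simp: inner_commute)
  have split: "(LINT s|M. g s \<bullet> f s) = (\<Sum>b\<in>Basis. (LINT s|M. (g s \<bullet> b) * (f s \<bullet> b)))"
    if f: "integrable M f" for f
  proof -
    have "(LINT s|M. g s \<bullet> f s) = (LINT s|M. (\<Sum>b\<in>Basis. (g s \<bullet> b) * (f s \<bullet> b)))"
      by (subst euclidean_inner) simp
    also have "\<dots> = (\<Sum>b\<in>Basis. (LINT s|M. (g s \<bullet> b) * (f s \<bullet> b)))"
      by (intro Bochner_Integration.integral_sum integrable_bounded_mult[where B=B] gb integrable_inner_left f)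
    finally show ?thesis .
  qed
  have "((\<lambda>i. \<Sum>b\<in>Basis. (LINT s|M. (g s \<bullet> b) * (z i s \<bullet> b))) \<longlongrightarrow> (\<Sum>b\<in>Basis. (LINT s|M. (g s \<bullet> b) * (x s \<bullet> b)))) G"
  proof (intro tendsto_sum tendsto_integral_bounded_mult[where B=B and C=C])
    fix b :: 'e assume b: "b \<in> Basis"
    show "eventually (\<lambda>i. integrable M (\<lambda>s. z i s \<bullet> b)) G"
      using int by eventually_elim simp
    show "eventually (\<lambda>i. (LINT s|M. \<bar>z i s \<bullet> b\<bar>) \<le> C) G"
      using bound int
    proof eventually_elim
      case (elim i)
      have "(LINT s|M. \<bar>z i s \<bullet> b\<bar>) \<le> (LINT s|M. norm (z i s))"
        using elim(2) Basis_le_norm[OF b] by (intro Bochner_Integration.integral_mono) auto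
      then show ?case using elim(1) by simp
    qed
  qed (use x gb conv in auto)
  moreover have "eventually (\<lambda>i. (\<Sum>b\<in>Basis. (LINT s|M. (g s \<bullet> b) * (z i s \<bullet> b))) = (LINT s|M. g s \<bullet> z i s)) G"
    using int by eventually_elim (simp add: split)
  ultimately show ?thesis unfolding split[OF x] by (rule Lim_transform_eventually)
qed

section \<open>Integrals of the convex function and weak lower semicontinuity\<close>

context differentiable_conjugate
begin

lemma measurable_rphi [measurable]: "rphi \<in> borel_measurable borel"
  unfolding rphi_def[abs_def] by measurable

lemma ereal_integral_phi:
  assumes dom: "AE s in M. f s \<in> phidom" and int: "integrable M (\<lambda>s. rphi (f s))"
  shows "ereal_integral M (\<lambda>s. \<phi> (f s)) = ereal (LINT s|M. rphi (f s))"
proof -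
  have "(\<integral>\<^sup>+ s. e2ennreal (\<phi> (f s)) \<partial>M) = (\<integral>\<^sup>+ s. ennreal (rphi (f s)) \<partial>M)"
    by (rule nn_integral_cong_AE) (use dom in eventually_elim, simp add: phi_dom)
  moreover have "(\<integral>\<^sup>+ s. e2ennreal (- \<phi> (f s)) \<partial>M) = (\<integral>\<^sup>+ s. ennreal (- rphi (f s)) \<partial>M)"
    by (rule nn_integral_cong_AE) (use dom in eventually_elim, simp add: phi_dom)
  moreover obtain r q where "0 \<le> r" "0 \<le> q" "(\<integral>\<^sup>+s. ennreal (rphi (f s)) \<partial>M) = ennreal r"
      "(\<integral>\<^sup>+s. ennreal (- rphi (f s)) \<partial>M) = ennreal q" "(LINT s|M. rphi (f s)) = r - q"
    using integrableE[OF int] by metis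
  ultimately show ?thesis by (simp add: ereal_integral_def enn2ereal_ennreal)
qed

lemma nn_integral_phi_neg_finite:
  assumes "finite_measure M"
  obtains K where "K \<ge> 0" "(\<integral>\<^sup>+ s. e2ennreal (- \<phi> (f s)) \<partial>M) \<le> ennreal K"
proof -
  interpret finite_measure M by fact
  \<comment> \<open>With \<open>R = 0\<close> the growth estimate is a constant lower bound,
    integrable because the measure is finite.\<close>
  obtain C where C: "C \<ge> 0" "\<And>v. ereal (0 * norm v - C) \<le> \<phi> v" using superlinear_growth[of 0] by auto
  have "- \<phi> v \<le> ereal C" for v
    using C(2)[of v] by (cases "\<phi> v") auto
  then have "e2ennreal (- \<phi> v) \<le> ennreal C" for v
    using e2ennreal_mono[of "- \<phi> v" "ereal C"] by simp
  then have "(\<integral>\<^sup>+ s. e2ennreal (- \<phi> (f s)) \<partial>M) \<le> (\<integral>\<^sup>+ s. ennreal C \<partial>M)"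
    by (intro nn_integral_mono) auto
  also have "\<dots> = ennreal (C * measure M (space M))"
    by (simp add: emeasure_eq_measure ennreal_mult C(1))
  finally show ?thesis using that[of "C * measure M (space M)"] C(1) by simp
qed

lemma ereal_integral_phi_not_minf:
  assumes "finite_measure M"
  shows "ereal_integral M (\<lambda>s. \<phi> (f s)) \<noteq> - \<infinity>"
proof -
  obtain K where "K \<ge> 0" "(\<integral>\<^sup>+ s. e2ennreal (- \<phi> (f s)) \<partial>M) \<le> ennreal K"
    using nn_integral_phi_neg_finite[OF assms] by blast
  then obtain q where "q \<ge> 0" "(\<integral>\<^sup>+ s. e2ennreal (- \<phi> (f s)) \<partial>M) = ennreal q"
    by (metis ennreal_cases ennreal_less_top not_le)
  then show ?thesis
    by (cases "\<integral>\<^sup>+ s. e2ennreal (\<phi> (f s)) \<partial>M")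
      (auto simp: ereal_integral_def enn2ereal_ennreal)
qed

lemma ereal_integral_phi_finiteD:
  assumes fin: "finite_measure M" and f: "f \<in> borel_measurable M"
    and less: "ereal_integral M (\<lambda>s. \<phi> (f s)) < \<infinity>"
  shows "AE s in M. f s \<in> phidom" "integrable M (\<lambda>s. rphi (f s))"
proof -
  note [measurable] = f
  obtain K where K: "K \<ge> 0" "(\<integral>\<^sup>+ s. e2ennreal (- \<phi> (f s)) \<partial>M) \<le> ennreal K"
    using nn_integral_phi_neg_finite[OF fin] by blast
  then obtain q where q: "q \<ge> 0" "(\<integral>\<^sup>+ s. e2ennreal (- \<phi> (f s)) \<partial>M) = ennreal q"
    by (metis ennreal_cases ennreal_less_top not_le)
  have pos: "(\<integral>\<^sup>+ s. e2ennreal (\<phi> (f s)) \<partial>M) \<noteq> \<infinity>"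
    using less by (auto simp: ereal_integral_def q enn2ereal_ennreal)
  then have "AE s in M. e2ennreal (\<phi> (f s)) \<noteq> \<infinity>"
    by (rule nn_integral_PInf_AE[rotated]) measurable
  then show dom: "AE s in M. f s \<in> phidom"
    by eventually_elim (auto simp: phidom_def less_top)
  have "(\<integral>\<^sup>+ s. e2ennreal (\<phi> (f s)) \<partial>M) = (\<integral>\<^sup>+ s. ennreal (rphi (f s)) \<partial>M)"
    by (rule nn_integral_cong_AE) (use dom in eventually_elim, simp add: phi_dom)
  moreover have "(\<integral>\<^sup>+ s. e2ennreal (- \<phi> (f s)) \<partial>M) = (\<integral>\<^sup>+ s. ennreal (- rphi (f s)) \<partial>M)"
    by (rule nn_integral_cong_AE) (use dom in eventually_elim, simp add: phi_dom)
  moreover have "(\<integral>\<^sup>+ s. e2ennreal (- \<phi> (f s)) \<partial>M) \<noteq> \<infinity>" unfolding q(2) by simp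
  ultimately show "integrable M (\<lambda>s. rphi (f s))"
    using pos by (simp add: real_integrable_def)
qed

text \<open>Integrals of affine functions converge over every measurable set. For a maximum of
  finitely many of them, the space is cut according to which one is largest at \<open>x\<close>;
  these pieces do not depend on \<open>i\<close>, and on each of them passing to the maximum can
  only increase the integral at \<open>z i\<close>. Monotone convergence then reaches the
  supremum.\<close>

lemma weak_lower_semicontinuity:
  fixes z :: "'i \<Rightarrow> 's \<Rightarrow> 'e"
  assumes fin: "finite_measure M" and G: "G \<noteq> bot"
    and int: "eventually (\<lambda>i. integrable M (z i)) G" and x: "integrable M x"
    and conv: "\<And>A b. A \<in> sets M \<Longrightarrow> b \<in> Basis \<Longrightarrow>
      ((\<lambda>i. LINT s:A|M. z i s \<bullet> b) \<longlongrightarrow> (LINT s:A|M. x s \<bullet> b)) G"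
    and le: "eventually (\<lambda>i. (AE s in M. z i s \<in> phidom) \<and> integrable M (\<lambda>s. rphi (z i s)) \<and>
      (LINT s|M. rphi (z i s)) \<le> \<alpha>) G"
  shows "AE s in M. x s \<in> phidom" "integrable M (\<lambda>s. rphi (x s))" "(LINT s|M. rphi (x s)) \<le> \<alpha>"
proof -
  interpret finite_measure M by fact
  have xm [measurable]: "x \<in> borel_measurable M" using x by auto
  obtain q where q: "\<And>x a. ereal a < \<phi> x \<Longrightarrow> \<exists>k::nat. a < x \<bullet> q k - cjg (q k)"
    using countable_biconjugate by blast
  define a where "a k v = v \<bullet> q k - cjg (q k)" for k v
  \<comment> \<open>The running maximum of \<open>a 0, ..., a n\<close>, increasing in
    \<open>n\<close>.\<close>
  define m where "m = rec_nat (a 0) (\<lambda>n f v. max (f v) (a (Suc n) v))"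
  have m0: "m 0 v = a 0 v" and mS: "m (Suc n) v = max (m n v) (a (Suc n) v)" for n v
    by (simp_all add: m_def)
  have m_mono: "m n v \<le> m n' v" if "n \<le> n'" for n n' v
    using that by (induction n' rule: dec_induct) (auto simp: mS)
  have a_m: "a n v \<le> m n v" for n v by (cases n) (auto simp: m0 mS)
  have m_rphi: "m n v \<le> rphi v" if "v \<in> phidom" for n v
    by (induction n) (use fenchel_young_dom[OF that] in \<open>auto simp: m0 mS a_def\<close>)
  have am [measurable]: "a k \<in> borel_measurable borel" for k
    unfolding a_def[abs_def] by measurable
  have mm [measurable]: "m n \<in> borel_measurable borel" for n
  proof (induction n)
    case (Suc n)
    note [measurable] = Suc
    show ?case unfolding mS[abs_def] by measurable
  qed (simp add: m0[abs_def])
  have a_int: "integrable M (\<lambda>s. a k (f s))" if "integrable M f" for k f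
    using that unfolding a_def by (intro Bochner_Integration.integrable_diff) auto
  have m_int: "integrable M (\<lambda>s. m n (f s))" if "integrable M f" for n f
    by (induction n) (use a_int[OF that] in \<open>auto simp: m0 mS\<close>)
  have set_int: "set_integrable M A f" if "integrable M f" "A \<in> sets M" for A and f :: "'s \<Rightarrow> real"
    using integrable_mult_indicator[OF that(2,1)] by (simp add: set_integrable_def)
  have a_conv: "((\<lambda>i. LINT s:A|M. a k (z i s)) \<longlongrightarrow> (LINT s:A|M. a k (x s))) G"
    if A: "A \<in> sets M" for k A
  proof -
    have e: "(LINT s:A|M. a k (f s)) = (\<Sum>b\<in>Basis. (q k \<bullet> b) * (LINT s:A|M. f s \<bullet> b)) - cjg (q k) * measure M A"
      if f: "integrable M f" for f
    proof -
      have c: "integrable M (\<lambda>s. cjg (q k))" by simp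
      have s: "set_integrable M A (\<lambda>s. (q k \<bullet> b) * (f s \<bullet> b))" for b
        by (intro set_int integrable_mult_right integrable_inner_left f A)
      have "(LINT s:A|M. a k (f s)) = (LINT s:A|M. f s \<bullet> q k) - (LINT s:A|M. cjg (q k))"
        unfolding a_def by (intro set_integral_diff(2) set_int c A integrable_inner_left f)
      also have "(LINT s:A|M. cjg (q k)) = cjg (q k) * measure M A"
        using A by (simp add: set_lebesgue_integral_def mult.commute)
      also have "(LINT s:A|M. f s \<bullet> q k) = (LINT s:A|M. (\<Sum>b\<in>Basis. (q k \<bullet> b) * (f s \<bullet> b)))"
        by (subst euclidean_inner) (simp add: mult.commute)
      also have "\<dots> = (\<Sum>b\<in>Basis. (LINT s:A|M. (q k \<bullet> b) * (f s \<bullet> b)))"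
        using s unfolding set_lebesgue_integral_def set_integrable_def scaleR_sum_right
        by (intro Bochner_Integration.integral_sum)
      finally show ?thesis by simp
    qed
    have "((\<lambda>i. (\<Sum>b\<in>Basis. (q k \<bullet> b) * (LINT s:A|M. z i s \<bullet> b)) - cjg (q k) * measure M A)
        \<longlongrightarrow> (LINT s:A|M. a k (x s))) G"
      unfolding e[OF x] by (intro tendsto_diff tendsto_sum tendsto_mult tendsto_const conv A)
    then show ?thesis
      by (rule Lim_transform_eventually) (use int in eventually_elim, simp add: e)
  qed
  \<comment> \<open>Stated for all sets \<open>A\<close> and all \<epsilon>, because the induction
    step applies it to a part of \<open>A\<close> with half of the tolerance.\<close>
  have m_lsc: "eventually (\<lambda>i. (LINT s:A|M. m n (x s)) \<le> (LINT s:A|M. m n (z i s)) + \<epsilon>) G"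
    if "A \<in> sets M" "\<epsilon> > 0" for A n \<epsilon>
    using that
  proof (induction n arbitrary: A \<epsilon>)
    case 0
    have "eventually (\<lambda>i. dist (LINT s:A|M. a 0 (z i s)) (LINT s:A|M. a 0 (x s)) < \<epsilon>) G"
      using a_conv[OF 0(1)] 0(2) by (rule tendstoD)
    then show ?case by eventually_elim (simp add: m0 dist_real_def)
  next
    case (Suc n)
    \<comment> \<open>On \<open>A1\<close> the new affine function wins at \<open>x\<close>, on
      \<open>A2\<close> the old maximum does.\<close>
    define A1 where "A1 = A \<inter> {s \<in> space M. m n (x s) < a (Suc n) (x s)}"
    define A2 where "A2 = A - {s \<in> space M. m n (x s) < a (Suc n) (x s)}"
    have D: "{s \<in> space M. m n (x s) < a (Suc n) (x s)} \<in> sets M" by measurable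
    have A12: "A1 \<in> sets M" "A2 \<in> sets M" "A = A1 \<union> A2" "A1 \<inter> A2 = {}"
      using D Suc.prems(1) by (auto simp: A1_def A2_def)
    have Asp: "A \<subseteq> space M" using Suc.prems(1) sets.sets_into_space by blast
    have split: "(LINT s:A|M. f s) = (LINT s:A1|M. f s) + (LINT s:A2|M. f s)"
      if "integrable M f" for f :: "'s \<Rightarrow> real"
      using set_integral_Un[OF A12(4) set_int[OF that A12(1)] set_int[OF that A12(2)]] A12(3) by simp
    have x1: "(LINT s:A1|M. m (Suc n) (x s)) = (LINT s:A1|M. a (Suc n) (x s))"
      unfolding set_lebesgue_integral_def
      by (intro Bochner_Integration.integral_cong) (auto simp: A1_def mS split: split_indicator)
    have x2: "(LINT s:A2|M. m (Suc n) (x s)) = (LINT s:A2|M. m n (x s))"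
      unfolding set_lebesgue_integral_def
      by (intro Bochner_Integration.integral_cong) (auto simp: A2_def mS split: split_indicator)
    have "eventually (\<lambda>i. dist (LINT s:A1|M. a (Suc n) (z i s)) (LINT s:A1|M. a (Suc n) (x s)) < \<epsilon>/2) G"
      using a_conv[OF A12(1)] Suc.prems(2) by (intro tendstoD) auto
    moreover have "eventually (\<lambda>i. (LINT s:A2|M. m n (x s)) \<le> (LINT s:A2|M. m n (z i s)) + \<epsilon>/2) G"
      using Suc.IH[OF A12(2), of "\<epsilon>/2"] Suc.prems(2) by simp
    ultimately show ?case
      using int
    proof eventually_elim
      case (elim i)
      have "(LINT s:A1|M. a (Suc n) (z i s)) \<le> (LINT s:A1|M. m (Suc n) (z i s))"
        by (intro set_integral_mono set_int a_int m_int elim A12) (simp add: mS)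
      moreover have "(LINT s:A2|M. m n (z i s)) \<le> (LINT s:A2|M. m (Suc n) (z i s))"
        by (intro set_integral_mono set_int a_int m_int elim A12) (simp add: mS)
      ultimately show ?case
        using elim(1,2) split[OF m_int[OF elim(3)], of "Suc n"] split[OF m_int[OF x], of "Suc n"]
        unfolding x1 x2 dist_real_def by linarith
    qed
  qed
  have whole: "(LINT s:space M|M. f s) = (LINT s|M. f s)" for f :: "'s \<Rightarrow> real"
    unfolding set_lebesgue_integral_def by (intro Bochner_Integration.integral_cong) auto
  have m_le: "(LINT s|M. m n (x s)) \<le> \<alpha>" for n
  proof (rule field_le_epsilon)
    fix \<epsilon> :: real assume "\<epsilon> > 0"
    then have "eventually (\<lambda>i. (LINT s|M. m n (x s)) \<le> (LINT s|M. m n (z i s)) + \<epsilon>) G"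
      using m_lsc[of "space M" \<epsilon> n] by (simp add: whole)
    then have "eventually (\<lambda>i. (LINT s|M. m n (x s)) \<le> \<alpha> + \<epsilon>) G"
      using le int
    proof eventually_elim
      case (elim i)
      have "(LINT s|M. m n (z i s)) \<le> (LINT s|M. rphi (z i s))"
      proof (rule integral_mono_AE)
        show "AE s in M. m n (z i s) \<le> rphi (z i s)"
          using elim(2) m_rphi by auto
      qed (use elim m_int in auto)
      then show ?case using elim by linarith
    qed
    then show "(LINT s|M. m n (x s)) \<le> \<alpha> + \<epsilon>" using G by (simp add: eventually_const)
  qed
  \<comment> \<open>The integrable function \<open>m 0\<close> is subtracted, so that the
    approximating sequence is nonnegative as monotone convergence requires.\<close>
  define c where "c = (LINT s|M. m 0 (x s))"
  have c: "c \<le> \<alpha>" using m_le[of 0] by (simp add: c_def)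
  have sup: "e2ennreal (\<phi> v - ereal (m 0 v)) \<le> (SUP n. ennreal (m n v - m 0 v))" for v
  proof (rule dense_le)
    fix y assume y: "y < e2ennreal (\<phi> v - ereal (m 0 v))"
    then have "y \<noteq> top" by auto
    then obtain r where r: "y = ennreal r" "r \<ge> 0" by (cases y) auto
    have "ereal (r + m 0 v) < \<phi> v"
    proof (rule ccontr)
      assume "\<not> ereal (r + m 0 v) < \<phi> v"
      then have "\<phi> v - ereal (m 0 v) \<le> ereal r"
        using phi_not_minf[of v] by (cases "\<phi> v") auto
      then have "e2ennreal (\<phi> v - ereal (m 0 v)) \<le> ennreal r"
        using e2ennreal_mono by fastforce
      then show False using y r by simp
    qed
    then obtain k where "r + m 0 v < a k v" using q by (auto simp: a_def)
    then have "r \<le> m k v - m 0 v" using a_m[of k v] by simp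
    then have "y \<le> ennreal (m k v - m 0 v)" by (simp add: r ennreal_leI)
    also have "\<dots> \<le> (SUP n. ennreal (m n v - m 0 v))" by (intro SUP_upper) simp
    finally show "y \<le> (SUP n. ennreal (m n v - m 0 v))" .
  qed
  have nn: "(\<integral>\<^sup>+ s. e2ennreal (\<phi> (x s) - ereal (m 0 (x s))) \<partial>M) \<le> ennreal (\<alpha> - c)"
  proof -
    have "(\<integral>\<^sup>+ s. e2ennreal (\<phi> (x s) - ereal (m 0 (x s))) \<partial>M)
        \<le> (\<integral>\<^sup>+ s. (SUP n. ennreal (m n (x s) - m 0 (x s))) \<partial>M)"
      by (intro nn_integral_mono sup)
    also have "\<dots> = (SUP n. (\<integral>\<^sup>+ s. ennreal (m n (x s) - m 0 (x s)) \<partial>M))"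
      by (rule nn_integral_monotone_convergence_SUP)
        (auto simp: incseq_def le_fun_def intro!: ennreal_leI diff_right_mono m_mono)
    also have "\<dots> \<le> ennreal (\<alpha> - c)"
    proof (rule SUP_least)
      fix n
      have "(\<integral>\<^sup>+ s. ennreal (m n (x s) - m 0 (x s)) \<partial>M) = ennreal (LINT s|M. m n (x s) - m 0 (x s))"
        by (intro nn_integral_eq_integral Bochner_Integration.integrable_diff m_int x AE_I2)
          (simp add: m_mono)
      also have "(LINT s|M. m n (x s) - m 0 (x s)) = (LINT s|M. m n (x s)) - c"
        unfolding c_def by (intro Bochner_Integration.integral_diff m_int x)
      also have "ennreal \<dots> \<le> ennreal (\<alpha> - c)" using m_le by (intro ennreal_leI) simp
      finally show "(\<integral>\<^sup>+ s. ennreal (m n (x s) - m 0 (x s)) \<partial>M) \<le> ennreal (\<alpha> - c)" .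
    qed
    finally show ?thesis .
  qed
  then have "(\<integral>\<^sup>+ s. e2ennreal (\<phi> (x s) - ereal (m 0 (x s))) \<partial>M) \<noteq> \<infinity>"
    by (auto simp: top_unique)
  then have "AE s in M. e2ennreal (\<phi> (x s) - ereal (m 0 (x s))) \<noteq> \<infinity>"
    by (rule nn_integral_PInf_AE[rotated]) measurable
  then show dom: "AE s in M. x s \<in> phidom"
  proof eventually_elim
    case (elim s)
    then show ?case using phi_not_dom[of "x s"] by (cases "x s \<in> phidom") auto
  qed
  have "(\<integral>\<^sup>+ s. e2ennreal (\<phi> (x s) - ereal (m 0 (x s))) \<partial>M) = (\<integral>\<^sup>+ s. ennreal (rphi (x s) - m 0 (x s)) \<partial>M)"
    by (rule nn_integral_cong_AE) (use dom in eventually_elim, simp add: phi_dom)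
  with nn have nn': "(\<integral>\<^sup>+ s. ennreal (rphi (x s) - m 0 (x s)) \<partial>M) \<le> ennreal (\<alpha> - c)" by simp
  have pos: "AE s in M. 0 \<le> rphi (x s) - m 0 (x s)"
    using dom by eventually_elim (use m_rphi in auto)
  have i: "integrable M (\<lambda>s. rphi (x s) - m 0 (x s))"
    by (rule integrableI_nonneg) (use pos nn' le_less_trans[OF nn' ennreal_less_top] in auto)
  then have "integrable M (\<lambda>s. (rphi (x s) - m 0 (x s)) + m 0 (x s))"
    by (rule Bochner_Integration.integrable_add[OF _ m_int[OF x]])
  then show r: "integrable M (\<lambda>s. rphi (x s))" by simp
  have "ennreal (LINT s|M. rphi (x s) - m 0 (x s)) \<le> ennreal (\<alpha> - c)"
    using nn' nn_integral_eq_integral[OF i pos] by simp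
  then have "(LINT s|M. rphi (x s) - m 0 (x s)) \<le> \<alpha> - c" using c by (simp add: ennreal_le_iff)
  then show "(LINT s|M. rphi (x s)) \<le> \<alpha>"
    using Bochner_Integration.integral_diff[OF r m_int[OF x, of 0]] by (simp add: c_def)
qed

text \<open>Equi-integrability in the manner of de la Vallee Poussin: first choose \<open>R\<close> large, then
  \<open>measure M A\<close> small.\<close>

lemma sublevel_integral_bound:
  assumes fin: "finite_measure M"
    and R: "R > 0" "\<And>v. ereal (R * norm v - C) \<le> \<phi> v" "C \<ge> 0"
    and C0: "\<And>v. ereal (- C0) \<le> \<phi> v" "C0 \<ge> 0"
    and f: "integrable M f" "AE s in M. f s \<in> phidom" "integrable M (\<lambda>s. rphi (f s))"
      "(LINT s|M. rphi (f s)) \<le> \<alpha>"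
    and A: "A \<in> sets M"
  shows "R * (LINT s:A|M. norm (f s)) \<le> \<bar>\<alpha>\<bar> + C0 * measure M (space M) + C * measure M A"
proof -
  interpret finite_measure M by fact
  have ind: "integrable M (\<lambda>s. indicator A s * g s)" if "integrable M g" for g :: "'a \<Rightarrow> real"
    using integrable_mult_indicator[OF A that] by simp
  have iA: "integrable M (indicator A :: _ \<Rightarrow> real)"
    using A by (intro integrable_real_indicator) (simp_all add: less_top[symmetric])
  have "R * (LINT s:A|M. norm (f s)) = (LINT s|M. R * (indicator A s * norm (f s)))"
    by (simp add: set_lebesgue_integral_def)
  also have "\<dots> \<le> (LINT s|M. (rphi (f s) + C0) + indicator A s * C)"
  proof (rule integral_mono_AE)
    show "integrable M (\<lambda>s. R * (indicator A s * norm (f s)))"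
      by (intro integrable_mult_right ind integrable_norm f)
    show "integrable M (\<lambda>s. (rphi (f s) + C0) + indicator A s * C)"
      using f(3) iA by (intro Bochner_Integration.integrable_add integrable_mult_left) auto
    \<comment> \<open>On \<open>A\<close> the growth estimate applies; off \<open>A\<close> the left
      side is 0 and \<open>C0\<close> makes the right side nonnegative.\<close>
    show "AE s in M. R * (indicator A s * norm (f s)) \<le> (rphi (f s) + C0) + indicator A s * C"
      using f(2)
    proof eventually_elim
      case (elim s)
      then show ?case
        using R(2)[of "f s"] C0(1)[of "f s"] C0(2) by (simp add: phi_dom split: split_indicator)
    qed
  qed
  also have "\<dots> = (LINT s|M. rphi (f s)) + C0 * measure M (space M) + C * measure M A"
    using f(3) iA A by (simp add: mult.commute)
  finally show ?thesis using f(4) by linarith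
qed

end

section \<open>The integral functional on \<open>L\<^sup>1\<close>\<close>

lemma L1_carrierE:
  assumes "u \<in> vcarrier (L1_space M)"
  shows "integrable M (L1_rep u)" "L1_class M (L1_rep u) = u"
proof -
  obtain f where f: "integrable M f" "u = L1_class M f"
    using assms by (auto simp: L1_space_def L1_class_def elim!: quotientE)
  show "integrable M (L1_rep u)" using L1_rep_AE(1)[OF f(1)] f(2) by simp
  then show "L1_class M (L1_rep u) = u"
    using L1_rep_AE[OF f(1)] f by (simp add: L1_class_eq_iff)
qed

text \<open>Testing with these functionals turns weak convergence into the setwise convergence
  assumed in \<open>weak_lower_semicontinuity\<close>.\<close>

lemma set_integral_in_dual_space:
  fixes b :: "'e::euclidean_space"
  assumes A: "A \<in> sets M" and b: "norm b \<le> 1"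
  shows "(\<lambda>u. LINT s:A|M. L1_rep u s \<bullet> b) \<in> dual_space (L1_space M)"
proof -
  let ?L = "\<lambda>u. LINT s:A|M. L1_rep u s \<bullet> b"
  have set_int: "set_integrable M A (\<lambda>s. f s \<bullet> b)" if "integrable M f" for f
    using integrable_mult_indicator[OF A integrable_inner_left[of b M f]] that by (simp add: set_integrable_def)
  have L: "?L (L1_class M f) = (LINT s:A|M. f s \<bullet> b)" if f: "integrable M f" for f
  proof -
    note r = L1_rep_AE[OF f]
    have "(LINT s|M. indicator A s *\<^sub>R (L1_rep (L1_class M f) s \<bullet> b)) = (LINT s|M. indicator A s *\<^sub>R (f s \<bullet> b))"
      by (rule integral_cong_AE) (use r f A in \<open>auto elim!: eventually_mono\<close>)
    then show ?thesis by (simp add: set_lebesgue_integral_def)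
  qed
  have "?L (vadd (L1_space M) u v) = ?L u + ?L v"
    if "u \<in> vcarrier (L1_space M)" "v \<in> vcarrier (L1_space M)" for u v
  proof -
    note u = L1_carrierE[OF that(1)] and v = L1_carrierE[OF that(2)]
    have "vadd (L1_space M) u v = L1_class M (\<lambda>s. L1_rep u s + L1_rep v s)"
      using L1_space_simps(2)[OF u(1) v(1)] by (simp add: u v)
    then show ?thesis
      using L[OF Bochner_Integration.integrable_add[OF u(1) v(1)]] set_int[OF u(1)] set_int[OF v(1)]
      by (simp add: inner_add_left)
  qed
  moreover have "?L (vscale (L1_space M) c u) = c * ?L u" if "u \<in> vcarrier (L1_space M)" for c u
  proof -
    note u = L1_carrierE[OF that]
    have "vscale (L1_space M) c u = L1_class M (\<lambda>s. c *\<^sub>R L1_rep u s)"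
      using L1_space_simps(3)[OF u(1) u(1)] by (simp add: u)
    then show ?thesis
      using L[of "\<lambda>s. c *\<^sub>R L1_rep u s"] u by simp
  qed
  moreover have "\<bar>?L u\<bar> \<le> 1 * vnorm (L1_space M) u" if "u \<in> vcarrier (L1_space M)" for u
  proof -
    note u = L1_carrierE[OF that]
    have "\<bar>?L u\<bar> \<le> (LINT s|M. norm (indicator A s *\<^sub>R (L1_rep u s \<bullet> b)))"
      using Bochner_Integration.integral_norm_bound[of M "\<lambda>s. indicator A s *\<^sub>R (L1_rep u s \<bullet> b)"]
      by (simp add: set_lebesgue_integral_def)
    also have "\<dots> \<le> (LINT s|M. norm (L1_rep u s))"
    proof (rule Bochner_Integration.integral_mono)
      show "integrable M (\<lambda>s. norm (indicator A s *\<^sub>R (L1_rep u s \<bullet> b)))"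
        using set_int[OF u(1)] unfolding set_integrable_def by (rule integrable_norm)
      show "norm (indicator A s *\<^sub>R (L1_rep u s \<bullet> b)) \<le> norm (L1_rep u s)" for s
        using Cauchy_Schwarz_ineq2[of "L1_rep u s" b] mult_left_mono[OF b norm_ge_zero[of "L1_rep u s"]]
        by (auto split: split_indicator)
    qed (use u in auto)
    also have "\<dots> = vnorm (L1_space M) u" by (simp add: L1_space_def)
    finally show ?thesis by simp
  qed
  ultimately show ?thesis unfolding dual_space_def by blast
qed

section \<open>The properties that make up strong rotundity\<close>

context differentiable_conjugate
begin

lemma integral_functional_rep:
  "integral_functional M \<phi> u = ereal_integral M (\<lambda>s. \<phi> (L1_rep u s))"
  by (simp add: integral_functional_def)

lemma integral_functional_finiteD:
  assumes "finite_measure M" "u \<in> vcarrier (L1_space M)" "integral_functional M \<phi> u < \<infinity>"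
  shows "AE s in M. L1_rep u s \<in> phidom" "integrable M (\<lambda>s. rphi (L1_rep u s))"
    "integral_functional M \<phi> u = ereal (LINT s|M. rphi (L1_rep u s))"
proof -
  have m: "L1_rep u \<in> borel_measurable M" using L1_carrierE(1)[OF assms(2)] by auto
  show 1: "AE s in M. L1_rep u s \<in> phidom" "integrable M (\<lambda>s. rphi (L1_rep u s))"
    using ereal_integral_phi_finiteD[OF assms(1) m] assms(3) by (simp_all add: integral_functional_rep)
  show "integral_functional M \<phi> u = ereal (LINT s|M. rphi (L1_rep u s))"
    using ereal_integral_phi[OF 1] by (simp add: integral_functional_rep)
qed

lemma proper_integral_functional:
  assumes "finite_measure M"
  shows "proper_on (vcarrier (L1_space M)) (integral_functional M \<phi>)"
proof -
  interpret finite_measure M by fact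
  obtain v where v: "v \<in> phidom" using phidom_nonempty by blast
  have i: "integrable M (\<lambda>s. v)" by simp
  have "integral_functional M \<phi> (L1_class M (\<lambda>s. v)) = ereal (LINT s|M. rphi v)"
    unfolding integral_functional_class[OF i] by (rule ereal_integral_phi) (use v in auto)
  then have "L1_class M (\<lambda>s. v) \<in> effective_domain (vcarrier (L1_space M)) (integral_functional M \<phi>)"
    using L1_space_simps(1)[OF i i] by (simp add: effective_domain_def)
  then show ?thesis
    using ereal_integral_phi_not_minf[OF assms] by (auto simp: proper_on_def integral_functional_rep)
qed

lemma strictly_convex_integral_functional:
  assumes "finite_measure M"
  shows "strictly_convex_on_domain (L1_space M) (integral_functional M \<phi>)"
  unfolding strictly_convex_on_domain_def
proof (intro ballI allI impI, elim conjE)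
  fix u v :: "('a \<Rightarrow> 'e) set" and t :: real
  assume u: "u \<in> effective_domain (vcarrier (L1_space M)) (integral_functional M \<phi>)"
    and v: "v \<in> effective_domain (vcarrier (L1_space M)) (integral_functional M \<phi>)"
    and neq: "u \<noteq> v" and t: "0 < t" "t < 1"
  interpret finite_measure M by fact
  define f where "f = L1_rep u"
  define g where "g = L1_rep v"
  have f: "integrable M f" "L1_class M f = u" "AE s in M. f s \<in> phidom" "integrable M (\<lambda>s. rphi (f s))"
      "integral_functional M \<phi> u = ereal (LINT s|M. rphi (f s))"
    using L1_carrierE[of u M] integral_functional_finiteD[OF assms, of u] u
    by (auto simp: f_def effective_domain_def)
  have g: "integrable M g" "L1_class M g = v" "AE s in M. g s \<in> phidom" "integrable M (\<lambda>s. rphi (g s))"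
      "integral_functional M \<phi> v = ereal (LINT s|M. rphi (g s))"
    using L1_carrierE[of v M] integral_functional_finiteD[OF assms, of v] v
    by (auto simp: g_def effective_domain_def)
  have [measurable]: "f \<in> borel_measurable M" "g \<in> borel_measurable M" using f g by auto
  define h where "h s = (1 - t) *\<^sub>R f s + t *\<^sub>R g s" for s
  have h: "integrable M h" unfolding h_def[abs_def] using f g by simp
  have vh: "vadd (L1_space M) (vscale (L1_space M) (1 - t) u) (vscale (L1_space M) t v) = L1_class M h"
  proof -
    have "vscale (L1_space M) (1 - t) u = L1_class M (\<lambda>s. (1 - t) *\<^sub>R f s)"
         "vscale (L1_space M) t v = L1_class M (\<lambda>s. t *\<^sub>R g s)"
      using L1_space_simps(3)[OF f(1) f(1)] L1_space_simps(3)[OF g(1) g(1)] by (simp_all add: f g)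
    then show ?thesis
      using L1_space_simps(2)[of M "\<lambda>s. (1 - t) *\<^sub>R f s" "\<lambda>s. t *\<^sub>R g s"] f g by (simp add: h_def[abs_def])
  qed
  have hdom: "AE s in M. h s \<in> phidom"
    using f(3) g(3) by eventually_elim (use t convex_combination(1) in \<open>simp add: h_def\<close>)
  obtain C where C: "C \<ge> 0" "\<And>v. ereal (0 * norm v - C) \<le> \<phi> v" using superlinear_growth[of 0] by auto
  have low: "- C \<le> rphi v" if "v \<in> phidom" for v
    using C(2)[of v] phi_dom[OF that] by simp
  have gap: "AE s in M. 0 \<le> (1 - t) * rphi (f s) + t * rphi (g s) - rphi (h s)"
    using f(3) g(3) by eventually_elim (use t convex_combination(2) in \<open>simp add: h_def\<close>)
  \<comment> \<open>The integrand lies between \<open>- C\<close> and an integrable convex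
    combination.\<close>
  have ih: "integrable M (\<lambda>s. rphi (h s))"
  proof (rule Bochner_Integration.integrable_bound)
    show "integrable M (\<lambda>s. C + \<bar>(1 - t) * rphi (f s) + t * rphi (g s)\<bar>)" using f g by simp
    show "(\<lambda>s. rphi (h s)) \<in> borel_measurable M" unfolding h_def by measurable
    show "AE s in M. norm (rphi (h s)) \<le> norm (C + \<bar>(1 - t) * rphi (f s) + t * rphi (g s)\<bar>)"
      using gap hdom
    proof eventually_elim
      case (elim s)
      then show ?case using low[of "h s"] C(1) by auto
    qed
  qed
  have igap: "integrable M (\<lambda>s. (1 - t) * rphi (f s) + t * rphi (g s) - rphi (h s))"
    using f g ih by simp
  \<comment> \<open>A nonnegative gap with zero integral vanishes almost everywhere, and strict
    convexity then identifies the representatives, hence the classes.\<close>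
  have "(LINT s|M. (1 - t) * rphi (f s) + t * rphi (g s) - rphi (h s)) \<noteq> 0"
  proof
    assume "(LINT s|M. (1 - t) * rphi (f s) + t * rphi (g s) - rphi (h s)) = 0"
    then have "AE s in M. (1 - t) * rphi (f s) + t * rphi (g s) - rphi (h s) = 0"
      using integral_nonneg_eq_0_iff_AE[OF igap gap] by simp
    then have "AE s in M. f s = g s"
      using f(3) g(3)
    proof eventually_elim
      case (elim s)
      then show ?case using strictly_convex_rphi[of "f s" "g s" t] t by (auto simp: h_def)
    qed
    then have "L1_class M f = L1_class M g" using f(1) g(1) by (simp add: L1_class_eq_iff)
    then show False using f g neq by simp
  qed
  moreover have "0 \<le> (LINT s|M. (1 - t) * rphi (f s) + t * rphi (g s) - rphi (h s))"
    using gap by (rule integral_nonneg_AE)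
  ultimately have "(LINT s|M. rphi (h s)) < (1 - t) * (LINT s|M. rphi (f s)) + t * (LINT s|M. rphi (g s))"
    using f(4) g(4) ih by simp
  then show "integral_functional M \<phi> (vadd (L1_space M) (vscale (L1_space M) (1 - t) u) (vscale (L1_space M) t v))
      < ereal (1 - t) * integral_functional M \<phi> u + ereal t * integral_functional M \<phi> v"
    unfolding vh integral_functional_class[OF h] ereal_integral_phi[OF hdom ih] f(5) g(5) by simp
qed

lemma weakly_compact_sublevel_sets:
  assumes "finite_measure M"
  shows "weakly_compact_level_sets (L1_space M) (integral_functional M \<phi>)"
  unfolding weakly_compact_level_sets_def
proof (rule allI, rule compactin_weak_topologyI)
  fix \<alpha> :: real
  interpret finite_measure M by fact
  let ?K = "{u \<in> vcarrier (L1_space M). integral_functional M \<phi> u \<le> ereal \<alpha>}"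
  show "?K \<subseteq> vcarrier (L1_space M)" by blast
  fix F :: "('a \<Rightarrow> 'e) set filter"
  assume F: "F \<noteq> bot" "eventually (\<lambda>u. u \<in> ?K) F"
  obtain G where G: "G \<le> F" "G \<noteq> bot"
    "\<And>h :: ('a \<Rightarrow> 'e) set \<Rightarrow> real. \<And>B. eventually (\<lambda>u. \<bar>h u\<bar> \<le> B) F \<Longrightarrow> \<exists>l. (h \<longlongrightarrow> l) G"
    using universal_subfilter[OF F(1)] by blast
  have K: "integrable M (L1_rep u)" "AE s in M. L1_rep u s \<in> phidom" "integrable M (\<lambda>s. rphi (L1_rep u s))"
      "(LINT s|M. rphi (L1_rep u s)) \<le> \<alpha>" "L1_class M (L1_rep u) = u" if "u \<in> ?K" for u
  proof -
    have u: "u \<in> vcarrier (L1_space M)" "integral_functional M \<phi> u \<le> ereal \<alpha>" using that by auto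
    then have "integral_functional M \<phi> u < \<infinity>" by auto
    note i = integral_functional_finiteD[OF assms u(1) this]
    show "integrable M (L1_rep u)" "L1_class M (L1_rep u) = u" using L1_carrierE[OF u(1)] by auto
    show "AE s in M. L1_rep u s \<in> phidom" "integrable M (\<lambda>s. rphi (L1_rep u s))"
      "(LINT s|M. rphi (L1_rep u s)) \<le> \<alpha>"
      using i u(2) by auto
  qed
  obtain C0 where C0: "C0 \<ge> 0" "\<And>v. ereal (0 * norm v - C0) \<le> \<phi> v" using superlinear_growth[of 0] by auto
  then have C0': "ereal (- C0) \<le> \<phi> v" for v using C0(2)[of v] by simp
  \<comment> \<open>The part of the bound that depends on neither \<open>R\<close> nor
    \<open>A\<close>; the absolute value keeps it nonnegative.\<close>
  define c where "c = \<bar>\<alpha>\<bar> + C0 * measure M (space M)"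
  have c: "c \<ge> 0" using C0(1) by (simp add: c_def)
  have bound: "\<exists>C\<ge>0. \<forall>u\<in>?K. \<forall>A\<in>sets M. R * (LINT s:A|M. norm (L1_rep u s)) \<le> c + C * measure M A"
    if "R > 0" for R
  proof -
    obtain C where C: "C \<ge> 0" "\<And>v. ereal (R * norm v - C) \<le> \<phi> v"
      using superlinear_growth[of R] \<open>R > 0\<close> by auto
    have "R * (LINT s:A|M. norm (L1_rep u s)) \<le> c + C * measure M A" if "u \<in> ?K" "A \<in> sets M" for u A
      unfolding c_def
      by (rule sublevel_integral_bound[OF assms \<open>R > 0\<close> C(2) C(1) C0' C0(1) K(1-4)[OF that(1)] that(2)])
    then show ?thesis using C(1) by blast
  qed
  have whole: "(LINT s:space M|M. f s) = (LINT s|M. f s)" for f :: "'a \<Rightarrow> real"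
    unfolding set_lebesgue_integral_def by (intro Bochner_Integration.integral_cong) auto
  obtain C1 where C1: "C1 \<ge> 0" "\<And>u A. u \<in> ?K \<Longrightarrow> A \<in> sets M \<Longrightarrow> 1 * (LINT s:A|M. norm (L1_rep u s)) \<le> c + C1 * measure M A"
    using bound[of 1] by auto
  define B where "B = c + C1 * measure M (space M)"
  have normB: "(LINT s|M. norm (L1_rep u s)) \<le> B" if "u \<in> ?K" for u
    using C1(2)[OF that sets.top] by (simp add: B_def whole)
  have GK: "eventually (\<lambda>u. u \<in> ?K) G" using G(1) F(2) by (rule filter_leD)
  obtain x where x: "integrable M x"
    "\<And>A b. A \<in> sets M \<Longrightarrow> b \<in> Basis \<Longrightarrow>
      ((\<lambda>u. LINT s:A|M. L1_rep u s \<bullet> b) \<longlongrightarrow> (LINT s:A|M. x s \<bullet> b)) G"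
  proof (rule weak_limit_exists[OF G(2), where z = "L1_rep :: ('a \<Rightarrow> 'e) set \<Rightarrow> 'a \<Rightarrow> 'e"])
    show "eventually (\<lambda>u. integrable M (L1_rep u)) G"
      using GK by eventually_elim (rule K(1))
  next
    fix \<epsilon> :: real assume e: "\<epsilon> > 0"
    \<comment> \<open>The choice of \<open>\<delta>\<close> below makes
      \<open>C * measure M A\<close> at most 1, and this \<open>R\<close> brings the remaining
      \<open>c + 1\<close> below \<open>R * \<epsilon>\<close>.\<close>
    define R where "R = 2 * (c + 1) / \<epsilon>"
    have R: "R > 0" using c e by (simp add: R_def)
    obtain C where C: "C \<ge> 0" "\<And>u A. u \<in> ?K \<Longrightarrow> A \<in> sets M \<Longrightarrow> R * (LINT s:A|M. norm (L1_rep u s)) \<le> c + C * measure M A"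
      using bound[OF R] by auto
    define \<delta> where "\<delta> = 1 / (C + 1)"
    have "\<delta> > 0" using C(1) by (simp add: \<delta>_def)
    moreover have "(LINT s:A|M. norm (L1_rep u s)) \<le> \<epsilon>"
      if A: "A \<in> sets M" "measure M A < \<delta>" and u: "u \<in> ?K" for A u
    proof -
      have "C * measure M A \<le> (C + 1) * measure M A" by (intro mult_right_mono) auto
      also have "\<dots> \<le> 1" using A(2) C(1) by (simp add: \<delta>_def field_simps)
      finally have "R * (LINT s:A|M. norm (L1_rep u s)) \<le> c + 1" using C(2)[OF u A(1)] by simp
      also have "c + 1 \<le> R * \<epsilon>" using e c by (simp add: R_def)
      finally show ?thesis using R by simp
    qed
    ultimately show "\<exists>\<delta>>0. \<forall>A\<in>sets M. measure M A < \<delta> \<longrightarrow>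
        eventually (\<lambda>u. (LINT s:A|M. norm (L1_rep u s)) \<le> \<epsilon>) G"
      using eventually_mono[OF GK] by (intro exI[of _ \<delta>]) auto
  next
    fix A and b :: 'e assume A: "A \<in> sets M"
    \<comment> \<open>Boundedness on the level set suffices for convergence along \<open>G\<close>,
      and the same \<open>G\<close> serves every \<open>A\<close> and \<open>b\<close>.\<close>
    have pos_bound: "\<bar>LINT s:A|M. max 0 (L1_rep u s \<bullet> b)\<bar> \<le> norm b * B" if u: "u \<in> ?K" for u
    proof -
      have "\<bar>LINT s:A|M. max 0 (L1_rep u s \<bullet> b)\<bar> \<le> (LINT s|M. norm (indicator A s *\<^sub>R max 0 (L1_rep u s \<bullet> b)))"
        using Bochner_Integration.integral_norm_bound[of M "\<lambda>s. indicator A s *\<^sub>R max 0 (L1_rep u s \<bullet> b)"]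
        by (simp add: set_lebesgue_integral_def)
      also have "\<dots> \<le> (LINT s|M. norm b * norm (L1_rep u s))"
      proof (rule Bochner_Integration.integral_mono)
        show "integrable M (\<lambda>s. norm (indicator A s *\<^sub>R max 0 (L1_rep u s \<bullet> b)))"
          using K(1)[OF u] by (intro integrable_norm integrable_mult_indicator[OF A] integrable_max integrable_inner_left) auto
        show "norm (indicator A s *\<^sub>R max 0 (L1_rep u s \<bullet> b)) \<le> norm b * norm (L1_rep u s)" for s
          using Cauchy_Schwarz_ineq2[of "L1_rep u s" b]
          by (auto split: split_indicator simp: mult.commute)
      qed (use K(1)[OF u] in auto)
      also have "\<dots> = norm b * (LINT s|M. norm (L1_rep u s))" by simp
      also have "\<dots> \<le> norm b * B" by (intro mult_left_mono normB u) auto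
      finally show ?thesis .
    qed
    have "eventually (\<lambda>u. \<bar>LINT s:A|M. max 0 (L1_rep u s \<bullet> b)\<bar> \<le> norm b * B) F"
      using F(2) by eventually_elim (rule pos_bound)
    then show "\<exists>l. ((\<lambda>u. LINT s:A|M. max 0 (L1_rep u s \<bullet> b)) \<longlongrightarrow> l) G" by (rule G(3))
  qed blast
  have Gint: "eventually (\<lambda>u. integrable M (L1_rep u)) G" using GK by eventually_elim (rule K(1))
  have Gle: "eventually (\<lambda>u. (AE s in M. L1_rep u s \<in> phidom) \<and> integrable M (\<lambda>s. rphi (L1_rep u s)) \<and>
      (LINT s|M. rphi (L1_rep u s)) \<le> \<alpha>) G"
  proof (rule eventually_mono[OF GK])
    fix u assume u: "u \<in> ?K"
    show "(AE s in M. L1_rep u s \<in> phidom) \<and> integrable M (\<lambda>s. rphi (L1_rep u s)) \<and>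
        (LINT s|M. rphi (L1_rep u s)) \<le> \<alpha>"
      by (intro conjI K(2-4)[OF u])
  qed
  have lsc: "AE s in M. x s \<in> phidom" "integrable M (\<lambda>s. rphi (x s))" "(LINT s|M. rphi (x s)) \<le> \<alpha>"
    by (rule weak_lower_semicontinuity[OF assms G(2) Gint x(1) _ Gle], erule (1) x(2))+
  have xK: "L1_class M x \<in> ?K"
    using L1_space_simps(1)[OF x(1) x(1)] lsc ereal_integral_phi[OF lsc(1,2)]
    by (simp add: integral_functional_class[OF x(1)])
  have "(\<Lambda> \<longlongrightarrow> \<Lambda> (L1_class M x)) G" if \<Lambda>: "\<Lambda> \<in> dual_space (L1_space M)" for \<Lambda>
  proof -
    obtain g B' where g: "g \<in> borel_measurable M" "\<And>s. norm (g s) \<le> B'"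
      "\<And>f. integrable M f \<Longrightarrow> \<Lambda> (L1_class M f) = (LINT s|M. g s \<bullet> f s)"
      using L1_dual_representation[OF assms \<Lambda>] by blast
    have "eventually (\<lambda>u. (LINT s|M. norm (L1_rep u s)) \<le> B) G"
      using GK by eventually_elim (rule normB)
    then have "((\<lambda>u. LINT s|M. g s \<bullet> L1_rep u s) \<longlongrightarrow> (LINT s|M. g s \<bullet> x s)) G"
      by (rule tendsto_integral_bounded_inner[OF Gint _ x(1) g(1)]) (use g(2) x(2) in auto)
    moreover have "eventually (\<lambda>u. (LINT s|M. g s \<bullet> L1_rep u s) = \<Lambda> u) G"
      using GK
    proof eventually_elim
      case (elim u)
      show ?case using g(3)[OF K(1)[OF elim]] K(5)[OF elim] by simp
    qed
    ultimately show ?thesis unfolding g(3)[OF x(1)] by (rule Lim_transform_eventually)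
  qed
  then show "\<exists>G x. G \<le> F \<and> G \<noteq> bot \<and> x \<in> ?K \<and> (\<forall>\<Lambda>\<in>dual_space (L1_space M). (\<Lambda> \<longlongrightarrow> \<Lambda> x) G)"
    using G(1,2) xK by blast
qed

lemma kadec_integral_functional:
  assumes fin: "finite_measure M"
  shows "kadec_property (L1_space M) (integral_functional M \<phi>)"
  unfolding kadec_property_def
proof (intro allI impI, elim conjE)
  fix u :: "nat \<Rightarrow> ('a \<Rightarrow> 'e) set" and x
  assume u: "\<forall>n. u n \<in> vcarrier (L1_space M)"
    and x: "x \<in> effective_domain (vcarrier (L1_space M)) (integral_functional M \<phi>)"
    and weak: "limitin (weak_topology (L1_space M)) u x sequentially"
    and val: "(\<lambda>n. integral_functional M \<phi> (u n)) \<longlonglongrightarrow> integral_functional M \<phi> x"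
  interpret finite_measure M by fact
  define w where "w = L1_rep x"
  have xc: "x \<in> vcarrier (L1_space M)" "integral_functional M \<phi> x < \<infinity>"
    using x by (auto simp: effective_domain_def)
  have w: "integrable M w" "L1_class M w = x" using L1_carrierE[OF xc(1)] by (auto simp: w_def)
  note wf = integral_functional_finiteD[OF fin xc, folded w_def]
  have [measurable]: "w \<in> borel_measurable M" using w by auto
  have norm_eq: "vnorm (L1_space M) (vdiff (L1_space M) (u n) x) = (LINT s|M. norm (L1_rep (u n) s - w s))" for n
  proof -
    have un: "integrable M (L1_rep (u n))" "L1_class M (L1_rep (u n)) = u n"
      using L1_carrierE[of "u n" M] u by auto
    have "vdiff (L1_space M) (u n) x = L1_class M (\<lambda>s. L1_rep (u n) s + (-1) *\<^sub>R w s)"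
      using L1_space_simps(3)[OF w(1) w(1), of "-1"] L1_space_simps(2)[OF un(1), of "\<lambda>s. (-1) *\<^sub>R w s"] un w
      by (simp add: vdiff_def)
    then show ?thesis
      using L1_space_simps(4)[of M "\<lambda>s. L1_rep (u n) s + (-1) *\<^sub>R w s"] un w by simp
  qed
  show "(\<lambda>n. vnorm (L1_space M) (vdiff (L1_space M) (u n) x)) \<longlonglongrightarrow> 0"
    unfolding norm_eq
  proof (rule ccontr)
    assume "\<not> (\<lambda>n. LINT s|M. norm (L1_rep (u n) s - w s)) \<longlonglongrightarrow> 0"
    then obtain e where e: "e > 0"
        "\<not> eventually (\<lambda>n. dist (LINT s|M. norm (L1_rep (u n) s - w s)) 0 < e) sequentially"
      unfolding tendsto_iff by blast
    have ev: "eventually (\<lambda>n. integral_functional M \<phi> (u n) < \<infinity>) sequentially"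
      using order_tendstoD(2)[OF val xc(2)] .
    \<comment> \<open>The implication lets a single subsequence both stay at distance
      \<open>e\<close> and have finite values of the functional, which are guaranteed only
      eventually.\<close>
    have "\<not> eventually (\<lambda>n. integral_functional M \<phi> (u n) < \<infinity> \<longrightarrow>
        dist (LINT s|M. norm (L1_rep (u n) s - w s)) 0 < e) sequentially"
      by (rule contrapos_nn[OF e(2)]) (rule eventually_mp[OF _ ev])
    then obtain r :: "nat \<Rightarrow> nat" where r: "strict_mono r" "\<And>n. integral_functional M \<phi> (u (r n)) < \<infinity>"
        "\<And>n. \<not> dist (LINT s|M. norm (L1_rep (u (r n)) s - w s)) 0 < e"
      using not_eventually_sequentiallyD by blast
    define z where "z n = L1_rep (u (r n))" for n
    define J where "J = (LINT s|M. rphi (w s))"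
    have zi: "integrable M (z n)" for n using L1_carrierE(1)[of "u (r n)" M] u by (simp add: z_def)
    have [measurable]: "z n \<in> borel_measurable M" for n using zi[of n] by auto
    have zf: "AE s in M. z n s \<in> phidom" "integrable M (\<lambda>s. rphi (z n s))"
        "integral_functional M \<phi> (u (r n)) = ereal (LINT s|M. rphi (z n s))" for n
      using integral_functional_finiteD[OF fin _ r(2)] u by (auto simp: z_def)
    have far: "e \<le> (LINT s|M. norm (z n s - w s))" for n
      using r(3)[of n] Bochner_Integration.integral_nonneg[of M "\<lambda>s. norm (z n s - w s)"]
      by (simp add: z_def dist_real_def)
    have zval: "(\<lambda>n. LINT s|M. rphi (z n s)) \<longlonglongrightarrow> J"
      using LIMSEQ_subseq_LIMSEQ[OF val r(1)] by (simp add: o_def zf(3) wf(3) J_def)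
    have conv: "(\<lambda>n. LINT s:A|M. z n s \<bullet> b) \<longlonglongrightarrow> (LINT s:A|M. w s \<bullet> b)"
      if "A \<in> sets M" "b \<in> Basis" for A b
    proof -
      have "(\<lambda>n. LINT s:A|M. L1_rep (u n) s \<bullet> b) \<longlonglongrightarrow> (LINT s:A|M. L1_rep x s \<bullet> b)"
        using that by (intro limitin_weak_topologyD[OF weak] set_integral_in_dual_space) auto
      from LIMSEQ_subseq_LIMSEQ[OF this r(1)] show ?thesis by (simp add: o_def z_def w_def)
    qed
    \<comment> \<open>The midpoints have the same weak limit \<open>w\<close>, so their integrals
      cannot fall below \<open>J\<close> in the limit, while the averages of the endpoint integrals
      tend to \<open>J\<close>.\<close>
    define mid where "mid n s = (1/2) *\<^sub>R (w s + z n s)" for n s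
    have [measurable]: "mid n \<in> borel_measurable M" for n unfolding mid_def[abs_def] by measurable
    have mid_i: "integrable M (mid n)" for n unfolding mid_def[abs_def] using w zi by simp
    have mid_dom: "AE s in M. mid n s \<in> phidom" for n
      using wf(1) zf(1)[of n] by eventually_elim (simp only: mid_def midpoint_dom)
    obtain C where C: "C \<ge> 0" "\<And>v. ereal (1 * norm v - C) \<le> \<phi> v" using superlinear_growth[of 1] by auto
    have growth: "norm v \<le> rphi v + C" if "v \<in> phidom" for v
      using C(2)[of v] phi_dom[OF that] by simp
    have low: "- C \<le> rphi v" if "v \<in> phidom" for v
      using growth[OF that] norm_ge_zero[of v] by linarith
    have gap_eq: "midpoint_gap (w s) (z n s) = rphi (z n s) / 2 + rphi (w s) / 2 - rphi (mid n s)" for n s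
      by (simp add: midpoint_gap_def mid_def)
    have gap_nonneg: "AE s in M. 0 \<le> midpoint_gap (w s) (z n s)" for n
      using wf(1) zf(1)[of n] by eventually_elim (rule midpoint_gap_nonneg)
    have mid_int: "integrable M (\<lambda>s. rphi (mid n s))" for n
    proof (rule Bochner_Integration.integrable_bound)
      show "integrable M (\<lambda>s. C + \<bar>rphi (z n s) / 2 + rphi (w s) / 2\<bar>)" using zf wf by simp
      show "(\<lambda>s. rphi (mid n s)) \<in> borel_measurable M" by measurable
      show "AE s in M. norm (rphi (mid n s)) \<le> norm (C + \<bar>rphi (z n s) / 2 + rphi (w s) / 2\<bar>)"
        using gap_nonneg[of n] mid_dom[of n]
      proof eventually_elim
        case (elim s)
        then show ?case using low[of "mid n s"] C(1) by (auto simp: gap_eq)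
      qed
    qed
    have gap_int: "integrable M (\<lambda>s. midpoint_gap (w s) (z n s))" for n
      unfolding gap_eq using zf wf mid_int by simp
    have gap_val: "(LINT s|M. midpoint_gap (w s) (z n s))
        = (LINT s|M. rphi (z n s)) / 2 + J / 2 - (LINT s|M. rphi (mid n s))" for n
      unfolding gap_eq J_def using zf wf mid_int by simp
    have mid_conv: "(\<lambda>n. LINT s:A|M. mid n s \<bullet> b) \<longlonglongrightarrow> (LINT s:A|M. w s \<bullet> b)"
      if A: "A \<in> sets M" and b: "b \<in> Basis" for A b
    proof -
      have set_int: "set_integrable M A (\<lambda>s. f s \<bullet> b)" if "integrable M f" for f
        using integrable_mult_indicator[OF A integrable_inner_left[of b M f]] that
        by (simp add: set_integrable_def)
      have mid_eq: "(LINT s:A|M. mid n s \<bullet> b) = (1/2) * ((LINT s:A|M. w s \<bullet> b) + (LINT s:A|M. z n s \<bullet> b))" for n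
        using set_integral_add(2)[OF set_int[OF w(1)] set_int[OF zi[of n]]]
        by (simp add: mid_def inner_add_left)
      have "(\<lambda>n. (1/2) * ((LINT s:A|M. w s \<bullet> b) + (LINT s:A|M. z n s \<bullet> b)))
          \<longlonglongrightarrow> (1/2) * ((LINT s:A|M. w s \<bullet> b) + (LINT s:A|M. w s \<bullet> b))"
        by (intro tendsto_intros conv A b)
      then show ?thesis unfolding mid_eq by simp
    qed
    \<comment> \<open>Otherwise a subsequence of midpoints would stay at level
      \<open>J - \<epsilon>\<close>, and weak lower semicontinuity would put \<open>w\<close> there
      too.\<close>
    have mid_low: "eventually (\<lambda>n. J - \<epsilon> < (LINT s|M. rphi (mid n s))) sequentially" if "\<epsilon> > 0" for \<epsilon>
    proof (rule ccontr)
      assume "\<not> ?thesis"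
      then obtain q :: "nat \<Rightarrow> nat" where q: "strict_mono q" "\<And>n. \<not> J - \<epsilon> < (LINT s|M. rphi (mid (q n) s))"
        using not_eventually_sequentiallyD by blast
      have "(LINT s|M. rphi (w s)) \<le> J - \<epsilon>"
      proof (rule weak_lower_semicontinuity(3)[OF fin, of sequentially "\<lambda>n. mid (q n)"])
        show "(\<lambda>n. LINT s:A|M. mid (q n) s \<bullet> b) \<longlonglongrightarrow> (LINT s:A|M. w s \<bullet> b)"
          if "A \<in> sets M" "b \<in> Basis" for A b
          using LIMSEQ_subseq_LIMSEQ[OF mid_conv[OF that] q(1)] by (simp add: o_def)
        show "eventually (\<lambda>n. (AE s in M. mid (q n) s \<in> phidom) \<and> integrable M (\<lambda>s. rphi (mid (q n) s)) \<and>
            (LINT s|M. rphi (mid (q n) s)) \<le> J - \<epsilon>) sequentially"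
          using mid_dom mid_int q(2) by (simp add: not_less)
      qed (use mid_i w in auto)
      then show False using \<open>\<epsilon> > 0\<close> by (simp add: J_def)
    qed
    have "(\<lambda>n. LINT s|M. norm (midpoint_gap (w s) (z n s))) \<longlonglongrightarrow> 0"
    proof -
      have n: "(LINT s|M. norm (midpoint_gap (w s) (z n s))) = (LINT s|M. midpoint_gap (w s) (z n s))" for n
        by (rule integral_cong_AE) (use gap_int[of n] gap_nonneg[of n] in \<open>auto elim!: eventually_mono\<close>)
      show ?thesis
        unfolding n
      proof (rule LIMSEQ_I)
        fix \<epsilon> :: real assume \<epsilon>: "0 < \<epsilon>"
        have "eventually (\<lambda>n. dist (LINT s|M. rphi (z n s)) J < \<epsilon>) sequentially"
          using zval \<epsilon> by (rule tendstoD)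
        moreover have "eventually (\<lambda>n. J - \<epsilon>/2 < (LINT s|M. rphi (mid n s))) sequentially"
          using mid_low[of "\<epsilon>/2"] \<epsilon> by simp
        ultimately have "eventually (\<lambda>n. norm ((LINT s|M. midpoint_gap (w s) (z n s)) - 0) < \<epsilon>) sequentially"
        proof eventually_elim
          case (elim n)
          have "0 \<le> (LINT s|M. midpoint_gap (w s) (z n s))"
            by (rule integral_nonneg_AE[OF gap_nonneg])
          then show ?case using elim by (simp add: gap_val dist_real_def)
        qed
        then show "\<exists>no. \<forall>n\<ge>no. norm ((LINT s|M. midpoint_gap (w s) (z n s)) - 0) < \<epsilon>"
          by (simp add: eventually_sequentially)
      qed
    qed
    then obtain q :: "nat \<Rightarrow> nat" where q: "strict_mono q"
        "AE s in M. (\<lambda>n. midpoint_gap (w s) (z (q n) s)) \<longlonglongrightarrow> 0"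
      using tendsto_L1_AE_subseq[of M "\<lambda>n s. midpoint_gap (w s) (z n s)"] gap_int by blast
    define y where "y n = z (q n)" for n
    have yi: "integrable M (y n)" for n using zi by (simp add: y_def)
    have [measurable]: "y n \<in> borel_measurable M" for n using yi[of n] by auto
    have y_all: "AE s in M. \<forall>n. y n s \<in> phidom"
      using zf(1) by (simp add: AE_all_countable y_def)
    have y_lim: "AE s in M. (\<lambda>n. y n s) \<longlonglongrightarrow> w s"
      using q(2) wf(1) y_all
    proof eventually_elim
      case (elim s)
      show ?case
      proof (rule tendstoI)
        fix \<epsilon> :: real assume "\<epsilon> > 0"
        then obtain \<delta> where \<delta>: "\<delta> > 0"
            "\<And>v. v \<in> phidom \<Longrightarrow> norm (v - w s) \<ge> \<epsilon> \<Longrightarrow> midpoint_gap (w s) v \<ge> \<delta>"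
          using midpoint_gap_separates[OF elim(2)] by blast
        have "eventually (\<lambda>n. midpoint_gap (w s) (z (q n) s) < \<delta>) sequentially"
          using order_tendstoD(2)[OF elim(1) \<delta>(1)] .
        then show "eventually (\<lambda>n. dist (y n s) (w s) < \<epsilon>) sequentially"
        proof eventually_elim
          case (elim n)
          show ?case
          proof (rule ccontr)
            assume "\<not> dist (y n s) (w s) < \<epsilon>"
            then have "\<delta> \<le> midpoint_gap (w s) (y n s)"
              using \<delta>(2)[of "y n s"] \<open>\<forall>n. y n s \<in> phidom\<close> by (simp add: dist_norm)
            then show False using elim by (simp add: y_def)
          qed
        qed
      qed
    qed
    \<comment> \<open>The growth estimate with \<open>R = 1\<close> makes this nonnegative. The
      distance enters with a minus sign, so Fatou's lemma gives an upper bound for it.\<close>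
    define h where "h n s = rphi (y n s) + C + norm (w s) - norm (y n s - w s)" for n s
    define k where "k s = rphi (w s) + C + norm (w s)" for s
    have h_int: "integrable M (h n)" for n
      unfolding h_def[abs_def] using zf(2)[of "q n"] yi[of n] w(1) by (simp add: y_def)
    have k_int: "integrable M k" unfolding k_def[abs_def] using wf(2) w(1) by simp
    have [measurable]: "h n \<in> borel_measurable M" for n using h_int[of n] by auto
    have h_nonneg: "AE s in M. 0 \<le> h n s" for n
      using y_all
    proof eventually_elim
      case (elim s)
      then show ?case using growth[of "y n s"] norm_triangle_ineq4[of "y n s" "w s"] by (simp add: h_def)
    qed
    have k_nonneg: "AE s in M. 0 \<le> k s"
      using wf(1)
    proof eventually_elim
      case (elim s)
      then show ?case using low[of "w s"] by (simp add: k_def)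
    qed
    have h_lim: "AE s in M. (\<lambda>n. h n s) \<longlonglongrightarrow> k s"
      using y_lim wf(1)
    proof eventually_elim
      case (elim s)
      \<comment> \<open>A finite convex function is continuous on its open domain, which contains
        \<open>w s\<close> for almost every \<open>s\<close>.\<close>
      have "isCont rphi (w s)"
        using rphi_continuous open_phidom elim(2) by (simp add: continuous_on_eq_continuous_at)
      then have "(\<lambda>n. rphi (y n s)) \<longlonglongrightarrow> rphi (w s)" using elim(1) by (rule isCont_tendsto_compose)
      moreover have "(\<lambda>n. norm (y n s - w s)) \<longlonglongrightarrow> 0"
        using elim(1) by (intro tendsto_norm_zero LIM_zero)
      ultimately have "(\<lambda>n. h n s) \<longlonglongrightarrow> rphi (w s) + C + norm (w s) - 0"
        unfolding h_def by (intro tendsto_intros)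
      then show ?case by (simp add: k_def)
    qed
    have hk: "(LINT s|M. h n s) \<le> (LINT s|M. rphi (y n s)) + C * measure M (space M) + (LINT s|M. norm (w s)) - e" for n
    proof -
      have "(LINT s|M. h n s) = (LINT s|M. rphi (y n s)) + C * measure M (space M) + (LINT s|M. norm (w s))
          - (LINT s|M. norm (y n s - w s))"
        unfolding h_def using zf(2)[of "q n"] yi[of n] w(1) by (simp add: y_def mult.commute)
      then show ?thesis using far[of "q n"] by (simp add: y_def)
    qed
    have kJ: "(LINT s|M. k s) = J + C * measure M (space M) + (LINT s|M. norm (w s))"
      unfolding k_def J_def using wf(2) w(1) by (simp add: mult.commute)
    \<comment> \<open>Since the distances stay at least \<open>e\<close>, the integrals of
      \<open>h n\<close> are bounded by quantities whose limit misses the integral of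
      \<open>k\<close> by \<open>e\<close>.\<close>
    define b where "b n = (LINT s|M. rphi (y n s)) + C * measure M (space M) + (LINT s|M. norm (w s)) - e" for n
    have b_lim: "b \<longlonglongrightarrow> (LINT s|M. k s) - e"
      unfolding b_def[abs_def] kJ
      using LIMSEQ_subseq_LIMSEQ[OF zval q(1)] by (intro tendsto_intros) (simp add: o_def y_def)
    have "ennreal (LINT s|M. k s) = (\<integral>\<^sup>+ s. ennreal (k s) \<partial>M)"
      using nn_integral_eq_integral[OF k_int k_nonneg] by simp
    also have "\<dots> = (\<integral>\<^sup>+ s. liminf (\<lambda>n. ennreal (h n s)) \<partial>M)"
    proof (rule nn_integral_cong_AE)
      show "AE s in M. ennreal (k s) = liminf (\<lambda>n. ennreal (h n s))"
        using h_lim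
      proof eventually_elim
        case (elim s)
        then have "(\<lambda>n. ennreal (h n s)) \<longlonglongrightarrow> ennreal (k s)" by (rule tendsto_ennrealI)
        then show ?case using lim_imp_Liminf[OF sequentially_bot] by metis
      qed
    qed
    also have "\<dots> \<le> liminf (\<lambda>n. \<integral>\<^sup>+ s. ennreal (h n s) \<partial>M)"
      by (rule nn_integral_liminf) measurable
    also have "\<dots> \<le> liminf (\<lambda>n. ennreal (b n))"
    proof (intro Liminf_mono always_eventually allI)
      fix n
      have "(\<integral>\<^sup>+ s. ennreal (h n s) \<partial>M) = ennreal (LINT s|M. h n s)"
        by (rule nn_integral_eq_integral[OF h_int h_nonneg])
      also have "\<dots> \<le> ennreal (b n)" using hk[of n] by (intro ennreal_leI) (simp add: b_def)
      finally show "(\<integral>\<^sup>+ s. ennreal (h n s) \<partial>M) \<le> ennreal (b n)" .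
    qed
    also have "\<dots> = ennreal ((LINT s|M. k s) - e)"
      by (rule lim_imp_Liminf[OF sequentially_bot tendsto_ennrealI[OF b_lim]])
    finally have "ennreal (LINT s|M. k s) \<le> ennreal ((LINT s|M. k s) - e)" .
    \<comment> \<open>\<open>ennreal\<close> sends negative reals to 0, so the sign must be known
      before the comparison is read in the reals.\<close>
    moreover have "0 \<le> (LINT s|M. k s) - e"
    proof (rule tendsto_lowerbound[OF b_lim])
      show "eventually (\<lambda>n. 0 \<le> b n) sequentially"
        using hk integral_nonneg_AE[OF h_nonneg] by (intro always_eventually allI) (smt (verit) b_def)
    qed simp
    ultimately show False using e(1) by (simp add: ennreal_le_iff)
  qed
qed

end

theorem theorem3p7:
  fixes M :: "'s measure" and \<phi> :: "'e::euclidean_space \<Rightarrow> ereal"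
  assumes "complete_measure M" and "finite_measure M" and "emeasure M (space M) \<noteq> 0"
    and "proper_on UNIV \<phi>" and "lsc \<phi>" and "convex_ereal \<phi>"
    and "open (effective_domain UNIV \<phi>)"
    and "\<forall>y. ereal_differentiable (fenchel_conjugate \<phi>) y"
  shows "strongly_rotund (L1_space M) (integral_functional M \<phi>)"
proof -
  interpret differentiable_conjugate \<phi>
    using assms by unfold_locales
  show ?thesis
    unfolding strongly_rotund_def
    by (intro conjI proper_integral_functional strictly_convex_integral_functional
      weakly_compact_sublevel_sets kadec_integral_functional assms(2))
qed

end
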